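(* Fix $0<q<1$. For each $n$ let $v\in S_n$ be Mallows distributed with parameter $q$, and let $w_0$ be distributed as an excursion in the Mallows process with parameter $q$, with $T_0$ its size. Then, as $n\to\infty$, $$\frac{\mathrm{Cov}(\mathrm{des}(v),\mathrm{des}(v^{-1}))}{\mathrm{Var}(\mathrm{des}(v))}\to\frac{\mathrm{Cov}\left(\mathrm{des}(w_0)-\frac{T_0q}{1+q},\,\mathrm{des}(w_0^{-1})-\frac{T_0q}{1+q}\right)}{\mathrm{Var}\left(\mathrm{des}(w_0)-\frac{T_0q}{1+q}\right)}.$$
   Context: For $u\in S_n$, $l(u)$ is the number of inversions (pairs $i<j$ with $u(i)>u(j)$) and $\mathrm{des}(u)=\#\{i\in\{1,\dots,n-1\}:u(i)>u(i+1)\}$. A random $v\in S_n$ is Mallows distributed with parameter $q$ if $\mathbf{P}(v=v_0)$ is proportional to $q^{l(v_0)}$. Mallows process ($0<q<1$): the random map $w:\mathbf{N}\to\mathbf{N}$, $\mathbf{N}=\{1,2,\dots\}$, with $\mathbf{P}(w(1)=i)=q^{i-1}(1-q)$ and, given $w(1),\dots,w(i)$, $w(i+1)=k\in\mathbf{N}\setminus\{w(1),\dots,w(i)\}$ with probability $q^{k'-1}(1-q)$, where $k'-1$ is the number of elements of $\mathbf{N}\setminus\{w(1),\dots,w(i)\}$ less than $k$. It is almost surely a bijection. A regeneration time is an $n\ge 1$ with $w(i)\le n$ for all $i\le n$, i.e. $w$ permutes $\{1,\dots,n\}$. Let $T_1$ be the first regeneration time and, in general, let $T_1,T_2,\dots$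 be such that $T_1+\dots+T_k$ is the $k$th regeneration time. The $k$th excursion $w_k\in S_{T_k}$ is the permutation given by the relative order of $w(T_1+\dots+T_{k-1}+1),\dots,w(T_1+\dots+T_k)$, and $T_k$ is its size. The pairs $(w_k,T_k)$ are independent and identically distributed; $(w_0,T_0)$ denotes a pair with this common distribution. *)

theory Defs
  imports "HOL-Probability.Probability" "HOL-Combinatorics.Permutations"
begin

text \<open>
  An element of \<open>S\<^sub>n\<close> is a function \<open>u :: nat \<Rightarrow> nat\<close> with \<open>u permutes {1..n}\<close>, hence the
  identity outside \<open>{1..n}\<close>; its inverse is \<open>inv u\<close>.
\<close>

definition perm_inversions :: "nat \<Rightarrow> (nat \<Rightarrow> nat) \<Rightarrow> nat" where
  "perm_inversions n u = card {(i, j). 1 \<le> i \<and> i < j \<and> j \<le> n \<and> u i > u j}"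

definition des :: "nat \<Rightarrow> (nat \<Rightarrow> nat) \<Rightarrow> nat" where
  "des n u = card {i \<in> {1..<n}. u i > u (i + 1)}"

definition mallows_weight :: "real \<Rightarrow> nat \<Rightarrow> real" where
  "mallows_weight q n = (\<Sum>u | u permutes {1..n}. q ^ perm_inversions n u)"

text \<open>
  A probability mass function if \<open>q > 0\<close> (see \<open>pmf_mallows\<close> below); unspecified otherwise.
\<close>

definition mallows :: "real \<Rightarrow> nat \<Rightarrow> (nat \<Rightarrow> nat) pmf" where
  "mallows q n = embed_pmf (\<lambda>u. if u permutes {1..n}
     then q ^ perm_inversions n u / mallows_weight q n else 0)"

lemma mallows_weight_pos:
  assumes "q > 0"
  shows "mallows_weight q n > 0"
  unfolding mallows_weight_def
proof (rule sum_pos)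
  show "finite {u. u permutes {1..n}}"
    by (simp add: finite_permutations)
  show "{u. u permutes {1..n}} \<noteq> {}"
    using permutes_id by blast
qed (use assms in simp)

lemma pmf_mallows:
  assumes "q > 0"
  shows "pmf (mallows q n) u =
    (if u permutes {1..n} then q ^ perm_inversions n u / mallows_weight q n else 0)"
  unfolding mallows_def
proof (rule pmf_embed_pmf)
  let ?S = "{u. u permutes {1..n}}"
  let ?f = "\<lambda>u. if u permutes {1..n} then q ^ perm_inversions n u / mallows_weight q n else 0"
  have fin: "finite ?S"
    by (simp add: finite_permutations)
  have pos: "mallows_weight q n > 0"
    using assms by (rule mallows_weight_pos)
  show nonneg: "0 \<le> ?f v" for v
    using assms pos by simp
  have "(\<integral>\<^sup>+v. ennreal (?f v) \<partial>count_space UNIV) = (\<Sum>v\<in>?S. ennreal (?f v))"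
    by (rule nn_integral_count_space'[OF fin]) auto
  also have "\<dots> = ennreal (\<Sum>v\<in>?S. ?f v)"
    using nonneg by (rule sum_ennreal)
  also have "(\<Sum>v\<in>?S. ?f v) = (\<Sum>v\<in>?S. q ^ perm_inversions n v / mallows_weight q n)"
    by (rule sum.cong) auto
  also have "\<dots> = 1"
    using pos by (simp add: sum_divide_distrib[symmetric] mallows_weight_def)
  finally show "(\<integral>\<^sup>+v. ennreal (?f v) \<partial>count_space UNIV) = 1"
    by simp
qed

text \<open>
  Only the values \<open>w \<omega> i\<close> with \<open>i \<ge> 1\<close> matter. In the last conjunct the conditioning event
  fixes the whole history \<open>w(1), \<dots>, w(i)\<close>; the exponent is the number of unused positive
  integers below \<open>k\<close>. The case \<open>i = 0\<close> of that conjunct would be the one before it.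
\<close>

definition mallows_process :: "real \<Rightarrow> 'a measure \<Rightarrow> ('a \<Rightarrow> nat \<Rightarrow> nat) \<Rightarrow> bool" where
  "mallows_process q M w \<longleftrightarrow>
     prob_space M \<and>
     (\<forall>i\<ge>1. (\<lambda>\<omega>. w \<omega> i) \<in> measurable M (count_space UNIV)) \<and>
     (\<forall>\<omega>\<in>space M. w \<omega> \<in> {1..} \<rightarrow> {1..}) \<and>
     (\<forall>k\<ge>1. \<P>(\<omega> in M. w \<omega> 1 = k) = q ^ (k - 1) * (1 - q)) \<and>
     (\<forall>i\<ge>1. \<forall>a. \<P>(\<omega> in M. \<forall>j\<in>{1..i}. w \<omega> j = a j) > 0 \<longrightarrow>
        (\<forall>k\<in>{1..} - a ` {1..i}.
           \<P>(\<omega> in M. w \<omega> (i + 1) = k \<bar> \<forall>j\<in>{1..i}. w \<omega> j = a j) =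
             q ^ card {m \<in> {1..} - a ` {1..i}. m < k} * (1 - q)))"

definition is_regeneration_time :: "(nat \<Rightarrow> nat) \<Rightarrow> nat \<Rightarrow> bool" where
  "is_regeneration_time s n \<longleftrightarrow> n \<ge> 1 \<and> (\<forall>i\<in>{1..n}. s i \<le> n)"

text \<open>
  \<open>regeneration_time s k\<close> is the \<open>k\<close>th regeneration time of \<open>s\<close>, with \<open>0\<close> for \<open>k = 0\<close>. If \<open>s\<close> has
  only finitely many regeneration times (an event of probability zero for the Mallows process),
  the later values are arbitrary.
\<close>

primrec regeneration_time :: "(nat \<Rightarrow> nat) \<Rightarrow> nat \<Rightarrow> nat" where
  "regeneration_time s 0 = 0"
| "regeneration_time s (Suc k) =
     (LEAST n. is_regeneration_time s n \<and> regeneration_time s k < n)"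

definition excursion_size :: "(nat \<Rightarrow> nat) \<Rightarrow> nat \<Rightarrow> nat" where
  "excursion_size s k = regeneration_time s k - regeneration_time s (k - 1)"

text \<open>
  The \<open>k\<close>th excursion for \<open>k \<ge> 1\<close>: position \<open>i\<close> is sent to the rank of its value among the values
  of \<open>s\<close> on the block following the \<open>(k - 1)\<close>st regeneration time.
\<close>

definition excursion :: "(nat \<Rightarrow> nat) \<Rightarrow> nat \<Rightarrow> nat \<Rightarrow> nat" where
  "excursion s k = (let R = regeneration_time s (k - 1); T = excursion_size s k in
     (\<lambda>i. if i \<in> {1..T} then card {j \<in> {1..T}. s (R + j) \<le> s (R + i)} else i))"

definition covariance :: "'a measure \<Rightarrow> ('a \<Rightarrow> real) \<Rightarrow> ('a \<Rightarrow> real) \<Rightarrow> real" where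
  "covariance M X Y =
     (LINT x|M. (X x - (LINT y|M. X y)) * (Y x - (LINT y|M. Y y)))"

end

theory Submission
  imports Defs
begin

text \<open>
  Give \<open>u \<in> S\<^sub>n\<close> the weight \<open>(1 - q)^n q^l(u)\<close>. Every permutation is uniquely a direct sum of
  permutations without proper regeneration times, weights are multiplicative, and both
  \<open>X(u) = des(u) - nq/(1+q)\<close> and \<open>Y(u) = X(u\<^sup>-\<^sup>1)\<close> are additive under direct sums. Let \<open>A\<close> be the generating
  function of the total weights, \<open>P\<close> the one restricted to excursions, and \<open>P\<^sub>X\<close>, \<open>P\<^sub>X\<^sub>Y\<close> the latter
  weighted further by \<open>X\<close>, \<open>XY\<close>. Then \<open>A = 1 + PA\<close>, and since \<open>des\<close> has Mallows mean
  \<open>(n - 1)c\<close> with \<open>c = q/(1+q)\<close>, also \<open>A P\<^sub>X = -cP\<close>. Hence the generating function of the weighted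
  sums of \<open>XY\<close> is \<open>A\<^sup>2 P\<^sub>X\<^sub>Y + 2c\<^sup>2(A - 1 - P)\<close>. As \<open>a\<^sub>n \<longlonglongrightarrow> \<alpha> > 0\<close> and excursion sizes have
  exponential tails, its \<open>n\<close>-th coefficient is \<open>\<alpha>\<^sup>2 n E[XY] + o(n)\<close>, so the Mallows covariance is
  \<open>\<alpha> n E[XY] + o(n)\<close>; the variance is the case \<open>Y = X\<close>, and \<open>P\<^sub>X = -c(P - P\<^sup>2)\<close> at \<open>z = 1\<close>
  gives \<open>E[X] = 0\<close>.
\<close>

subsection \<open>Renewal asymptotics for power series\<close>

text \<open>There are \<open>n + 1\<close> terms over the divisor \<open>n\<close>, so the constant
  part contributes \<open>L + L / n\<close>; the deviations from \<open>L\<close> average to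
  \<open>0\<close>.\<close>

lemma cesaro_mean:
  fixes f :: "nat \<Rightarrow> real"
  assumes "f \<longlonglongrightarrow> L"
  shows "(\<lambda>n. (\<Sum>k\<le>n. f k) / real n) \<longlonglongrightarrow> L"
proof -
  define g where "g k = f k - L" for k
  have g: "g \<longlonglongrightarrow> 0"
    using assms unfolding g_def by (simp add: LIM_zero)
  have "(\<lambda>n. (\<Sum>k\<le>n. g k) / real n) \<longlonglongrightarrow> 0"
  proof (rule LIMSEQ_I)
    fix e :: real assume e: "e > 0"
    then obtain N where N: "\<And>k. k \<ge> N \<Longrightarrow> \<bar>g k\<bar> < e / 2"
      using LIMSEQ_D[OF g, of "e / 2"] by auto
    define B where "B = (\<Sum>k\<le>N. \<bar>g k\<bar>)"
    have bound: "\<bar>\<Sum>k\<le>n. g k\<bar> \<le> B + real n * (e / 2)" if "n \<ge> N" for n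
      using that
    proof (induction n rule: dec_induct)
      case base
      have "\<bar>\<Sum>k\<le>N. g k\<bar> \<le> B" unfolding B_def by (rule sum_abs)
      then show ?case using e by (smt (verit) mult_nonneg_nonneg of_nat_0_le_iff half_gt_zero)
    next
      case (step n)
      have "\<bar>g (Suc n)\<bar> < e / 2" using N[of "Suc n"] step by simp
      then show ?case
        using step(3) unfolding sum.atMost_Suc of_nat_Suc distrib_right by linarith
    qed
    obtain K :: nat where K: "real K > 2 * B / e" using reals_Archimedean2 by blast
    have "norm ((\<Sum>k\<le>n. g k) / real n - 0) < e" if n: "n \<ge> max (Suc N) K" for n
    proof -
      have "real n > 2 * B / e" using K n by linarith
      then have "B < real n * (e / 2)" using e by (simp add: field_simps)
      moreover have "\<bar>\<Sum>k\<le>n. g k\<bar> \<le> B + real n * (e / 2)" using bound n by simp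
      ultimately have "\<bar>\<Sum>k\<le>n. g k\<bar> < real n * e" by simp
      then show ?thesis using n by (simp add: field_simps)
    qed
    then show "\<exists>no. \<forall>n\<ge>no. norm ((\<Sum>k\<le>n. g k) / real n - 0) < e" by blast
  qed
  moreover have "(\<lambda>n. L + L / real n) \<longlonglongrightarrow> L + 0"
    by (intro tendsto_intros lim_const_over_n)
  ultimately have "(\<lambda>n. (\<Sum>k\<le>n. g k) / real n + (L + L / real n)) \<longlonglongrightarrow> 0 + (L + 0)"
    by (rule tendsto_add)
  moreover have "eventually (\<lambda>n. (\<Sum>k\<le>n. g k) / real n + (L + L / real n) = (\<Sum>k\<le>n. f k) / real n) sequentially"
    using eventually_gt_at_top[of 0]
    by eventually_elim (simp add: g_def sum_subtractf field_simps)
  ultimately show ?thesis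
    by (simp add: filterlim_cong[OF refl refl])
qed

text \<open>Absolute convergence at \<open>z = 1\<close> with value \<open>s\<close> there;
  absoluteness is what lets values multiply along Cauchy products.\<close>

definition abs_sums :: "real fps \<Rightarrow> real \<Rightarrow> bool" where
  "abs_sums f s \<longleftrightarrow> summable (\<lambda>n. \<bar>fps_nth f n\<bar>) \<and> fps_nth f sums s"

lemma abs_sums_mult:
  assumes "abs_sums f s" and "abs_sums g t"
  shows "abs_sums (f * g) (s * t)"
proof -
  have eq: "fps_nth (f * g) = (\<lambda>k. \<Sum>i\<le>k. fps_nth f i * fps_nth g (k - i))"
    by (rule ext) (simp add: fps_mult_nth atLeast0AtMost)
  have f: "summable (\<lambda>n. norm (fps_nth f n))" "(\<Sum>n. fps_nth f n) = s"
    and g: "summable (\<lambda>n. norm (fps_nth g n))" "(\<Sum>n. fps_nth g n) = t"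
    using assms by (auto simp: abs_sums_def sums_iff)
  have "summable (\<lambda>k. \<Sum>i\<le>k. \<bar>fps_nth f i\<bar> * \<bar>fps_nth g (k - i)\<bar>)"
    using summable_Cauchy_product[of "\<lambda>n. \<bar>fps_nth f n\<bar>" "\<lambda>n. \<bar>fps_nth g n\<bar>"] f g by simp
  then have "summable (\<lambda>k. \<bar>fps_nth (f * g) k\<bar>)"
    by (rule summable_comparison_test[rotated])
       (auto simp: eq abs_mult intro!: exI[of _ 0] order.trans[OF sum_abs])
  then show ?thesis
    using Cauchy_product_sums[OF f(1) g(1)] f(2) g(2) by (simp add: abs_sums_def eq)
qed

lemma abs_sums_diff:
  assumes "abs_sums f s" and "abs_sums g t"
  shows "abs_sums (f - g) (s - t)"
proof -
  have "summable (\<lambda>n. \<bar>fps_nth f n\<bar> + \<bar>fps_nth g n\<bar>)"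
    using assms unfolding abs_sums_def by (intro summable_add) auto
  then have "summable (\<lambda>n. \<bar>fps_nth (f - g) n\<bar>)"
    by (rule summable_comparison_test[rotated]) (auto intro!: exI[of _ 0])
  moreover have "fps_nth (f - g) = (\<lambda>n. fps_nth f n - fps_nth g n)"
    by (rule ext) simp
  ultimately show ?thesis
    using assms sums_diff[of "fps_nth f" s "fps_nth g" t] by (simp add: abs_sums_def)
qed

abbreviation fps_ones :: "real fps" where
  "fps_ones \<equiv> Abs_fps (\<lambda>_. 1)"

lemma nth_mult_ones: "fps_nth (f * fps_ones) n = (\<Sum>k\<le>n. fps_nth f k)"
  by (simp add: fps_mult_nth atLeast0AtMost)

text \<open>The series \<open>fps_ones\<close> is \<open>1 / (1 - z)\<close>. One factor gives the
  partial sums of \<open>h\<close>, which tend to \<open>s\<close>; the second sums these again, so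
  the quotient by \<open>n\<close> is a Cesaro average. This takes the place of analysing a double
  pole at \<open>z = 1\<close>.\<close>

lemma abs_sums_ones_ones:
  assumes "abs_sums h s"
  shows "(\<lambda>n. fps_nth (h * fps_ones * fps_ones) n / real n) \<longlonglongrightarrow> s"
  unfolding nth_mult_ones
  by (rule cesaro_mean) (use assms in \<open>simp add: abs_sums_def sums_def_le\<close>)

section \<open>Finite q-Pochhammer products \<open>(q; q)_n\<close> and the tails of the associated
  renewal sequence\<close>

definition qprod :: "real \<Rightarrow> nat \<Rightarrow> real" where
  "qprod q n = (\<Prod>i=1..n. 1 - q ^ i)"

lemma qprod_Suc: "qprod q (Suc n) = qprod q n * (1 - q ^ Suc n)"
  by (simp add: qprod_def)

lemma qprod_0 [simp]: "qprod q 0 = 1"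
  by (simp add: qprod_def)

lemma qprod_bounds:
  assumes "0 < q" "q < 1"
  shows "0 < qprod q n" "qprod q n \<le> 1"
proof (induction n)
  case (Suc n)
  have "q ^ Suc n < 1" "0 < q ^ Suc n" using assms by (auto simp only: power_Suc_less_one zero_less_power)
  then show "0 < qprod q (Suc n)" "qprod q (Suc n) \<le> 1"
    using Suc unfolding qprod_Suc by (auto intro: mult_le_one simp del: power_Suc)
qed auto

text \<open>Summability of the powers of \<open>q\<close> makes the infinite product converge, and
  as no factor vanishes the limit is not \<open>0\<close>.\<close>

lemma qprod_limit:
  assumes "0 < q" "q < 1"
  shows "\<exists>\<alpha>>0. qprod q \<longlonglongrightarrow> \<alpha>"
proof -
  have "summable (\<lambda>i. norm ((1 - q ^ Suc i) - 1))"
    using assms by (auto simp: summable_mult summable_geometric)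
  then have "abs_convergent_prod (\<lambda>i. 1 - q ^ Suc i)"
    by (subst abs_convergent_prod_conv_summable)
  then have conv: "convergent_prod (\<lambda>i. 1 - q ^ Suc i)"
    by (rule abs_convergent_prod_imp_convergent_prod)
  have ne: "1 - q ^ Suc i \<noteq> 0" for i
    using assms power_Suc_less_one[of q i] by simp
  have eq: "(\<Prod>i\<le>n. 1 - q ^ Suc i) = qprod q (Suc n)" for n
    by (induction n) (simp_all add: qprod_Suc)
  have lim: "(\<lambda>n. qprod q (Suc n)) \<longlonglongrightarrow> (\<Prod>i. 1 - q ^ Suc i)"
    using convergent_prod_LIMSEQ[OF conv] by (simp only: eq)
  have "(\<Prod>i. 1 - q ^ Suc i) \<ge> 0"
    by (rule LIMSEQ_le_const[OF lim]) (use qprod_bounds[OF assms] in \<open>auto intro: less_imp_le\<close>)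
  moreover have "(\<Prod>i. 1 - q ^ Suc i) \<noteq> 0"
    by (rule prodinf_nonzero[OF conv ne])
  ultimately show ?thesis
    using lim by (auto simp: filterlim_sequentially_Suc intro!: exI[of _ "\<Prod>i. 1 - q ^ Suc i"])
qed

text \<open>
  The tails \<open>c\<^sub>n = 1 - (p\<^sub>1 + \<dots> + p\<^sub>n)\<close> solve the defective renewal equation with weights
  \<open>a\<^sub>k\<^sub>-\<^sub>1 - a\<^sub>k\<close>, whose generating function stays below \<open>1\<close> slightly beyond \<open>z = 1\<close>.
\<close>
lemma renewal_exponential_tail:
  fixes P :: "real fps" and a :: "nat \<Rightarrow> real"
  assumes q: "0 < q" "q < 1"
    and ren: "Abs_fps (qprod q) = 1 + P * Abs_fps (qprod q)"
    and pos: "\<And>n. fps_nth P n \<ge> 0"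
  shows "\<exists>\<rho>. 0 < \<rho> \<and> \<rho> < 1 \<and> (\<forall>n. fps_nth P n \<le> \<rho> ^ (n - 1))" and "fps_nth P sums 1"
proof -
  define A where "A = Abs_fps (qprod q)"
  have A: "A = 1 + P * A" using ren by (simp add: A_def)
  have p0: "fps_nth P 0 = 0"
    using arg_cong[OF A, of "\<lambda>f. fps_nth f 0"] by (simp add: A_def)
  \<comment> \<open>For \<open>k > 0\<close> this is the decrement
    \<open>qprod q (k - 1) - qprod q k\<close>, so \<open>B\<close> is \<open>(1 - z) * A\<close>.
    The product form shows \<open>0 \<le> d k \<le> q ^ k\<close>.\<close>
  define d where "d k = (if k = 0 then 0 else qprod q (k - 1) * q ^ k)" for k
  define B where "B = 1 - Abs_fps d"
  have AB: "A = B * fps_ones"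
  proof (rule fps_ext)
    fix n show "fps_nth A n = fps_nth (B * fps_ones) n"
      unfolding nth_mult_ones
      by (induction n) (simp_all add: A_def B_def d_def qprod_Suc algebra_simps)
  qed
  \<comment> \<open>The coefficients of \<open>C\<close> are the tails. As
    \<open>(1 - P) * A = 1\<close>, also \<open>C * B = 1\<close>, which is their renewal equation
    with weights \<open>d\<close>.\<close>
  define C where "C = (1 - P) * fps_ones"
  have "C * B = (1 - P) * A" by (simp add: C_def AB mult_ac)
  also have "\<dots> = 1" using A by (simp add: algebra_simps)
  finally have Ceq: "C = 1 + Abs_fps d * C" by (simp add: B_def algebra_simps)
  then have Crec: "fps_nth C n = (\<Sum>i=1..n. d i * fps_nth C (n - i))" if "n > 0" for n
  proof -
    have "fps_nth C n = (\<Sum>i=0..n. d i * fps_nth C (n - i))"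
      using arg_cong[OF Ceq, of "\<lambda>f. fps_nth f n"] that by (simp add: fps_mult_nth)
    then show ?thesis by (simp add: sum.atLeast_Suc_atMost d_def)
  qed
  have C0: "fps_nth C 0 = 1" by (simp add: C_def p0)
  have CSuc: "fps_nth C (Suc n) = fps_nth C n - fps_nth P (Suc n)" for n
    by (simp add: C_def nth_mult_ones)
  have Csum: "(\<Sum>k<n. fps_nth P k) = 1 - fps_nth C (n - 1)" if "n > 0" for n
    using that
  proof (induction n)
    case (Suc n) then show ?case by (cases n) (simp_all add: p0 C0 CSuc)
  qed simp
  have d_nonneg: "d k \<ge> 0" for k
    using qprod_bounds[OF q] q by (simp add: d_def less_imp_le)
  have d_le: "d k \<le> q ^ k" for k
    using qprod_bounds[OF q] q by (simp add: d_def mult_left_le_one_le less_imp_le)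
  obtain \<alpha> where \<alpha>: "\<alpha> > 0" "qprod q \<longlonglongrightarrow> \<alpha>" using qprod_limit[OF q] by blast
  have "(\<Sum>k<Suc n. d k) = 1 - qprod q n" for n
    by (induction n) (simp_all add: d_def qprod_Suc algebra_simps)
  moreover have "(\<lambda>n. 1 - qprod q n) \<longlonglongrightarrow> 1 - \<alpha>" using \<alpha> by (intro tendsto_intros)
  ultimately have "(\<lambda>n. \<Sum>k<n. d k) \<longlonglongrightarrow> 1 - \<alpha>"
    by (subst filterlim_sequentially_Suc[symmetric]) simp
  then have dsum: "d sums (1 - \<alpha>)" by (simp add: sums_def)
  \<comment> \<open>The midpoint of \<open>1\<close> and \<open>1 / q\<close>: the series of
    \<open>d\<close> still converges at \<open>K\<close> because \<open>q * K < 1\<close>, and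
    \<open>1\<close> lies inside its domain.\<close>
  define K where "K = (1 / q + 1) / 2"
  have K: "1 < K" "K < 1 / q" "q * K < 1" using q by (auto simp: K_def field_simps)
  have summ: "summable (\<lambda>n. d n * x ^ n)" if "0 \<le> x" "x \<le> K" for x
  proof (rule summable_comparison_test)
    show "\<exists>N. \<forall>n\<ge>N. norm (d n * x ^ n) \<le> (q * K) ^ n"
    proof (intro exI[of _ 0] allI impI)
      fix n :: nat
      have "d n * x ^ n \<le> q ^ n * K ^ n"
        by (intro mult_mono d_le power_mono) (use that q in auto)
      then show "norm (d n * x ^ n) \<le> (q * K) ^ n"
        using d_nonneg[of n] that by (simp add: power_mult_distrib)
    qed
    show "summable ((^) (q * K))" using K q by (simp add: summable_geometric)
  qed
  \<comment> \<open>At \<open>x = 1\<close> the decrements telescope to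
    \<open>1 - \<alpha> < 1\<close>; by continuity the series stays below \<open>1\<close> at some
    \<open>r > 1\<close>.\<close>
  have "isCont (\<lambda>x. \<Sum>n. d n * x ^ n) 1"
    by (rule isCont_powser[OF summ[of K]]) (use K in auto)
  moreover have "(\<Sum>n. d n * 1 ^ n) < 1" using dsum \<alpha> by (simp add: sums_iff)
  ultimately have "\<forall>\<^sub>F x in at 1. (\<Sum>n. d n * x ^ n) < 1"
    by (auto simp: isCont_def intro: order_tendstoD)
  then obtain \<delta> where \<delta>: "\<delta> > 0" "\<And>x. x \<noteq> 1 \<Longrightarrow> dist x 1 < \<delta> \<Longrightarrow> (\<Sum>n. d n * x ^ n) < 1"
    unfolding eventually_at by blast
  define r where "r = 1 + min \<delta> (K - 1) / 2"
  have r12: "1 < r" "r < K" and "dist r 1 < \<delta>"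
    using \<delta>(1) K(1) by (auto simp: r_def dist_real_def min_def field_simps)
  then have r: "(\<Sum>n. d n * r ^ n) < 1" "1 < r" "r < K"
    using \<delta>(2)[of r] by auto
  define \<rho> where "\<rho> = 1 / r"
  have \<rho>: "0 < \<rho>" "\<rho> < 1" using r by (auto simp: \<rho>_def)
  \<comment> \<open>Strong induction: the renewal equation bounds the \<open>n\<close>-th tail by
    \<open>\<rho> ^ n\<close> times a partial sum of the series of \<open>d\<close> at
    \<open>r\<close>, which is below \<open>1\<close>.\<close>
  have Cb: "0 \<le> fps_nth C n \<and> fps_nth C n \<le> \<rho> ^ n" for n
  proof (induction n rule: less_induct)
    case (less n)
    show ?case
    proof (cases "n = 0")
      case False
      have nonneg: "fps_nth C n \<ge> 0"
        unfolding Crec[OF False[unfolded neq0_conv]]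
        by (intro sum_nonneg mult_nonneg_nonneg d_nonneg) (use less in auto)
      have "fps_nth C n \<le> (\<Sum>i=1..n. d i * \<rho> ^ (n - i))"
        unfolding Crec[OF False[unfolded neq0_conv]]
        by (intro sum_mono mult_left_mono d_nonneg) (use less in auto)
      also have "\<dots> = \<rho> ^ n * (\<Sum>i=1..n. d i * r ^ i)"
        unfolding sum_distrib_left
        by (intro sum.cong) (use r in \<open>auto simp: \<rho>_def power_diff field_simps\<close>)
      also have "\<dots> \<le> \<rho> ^ n * 1"
      proof (rule mult_left_mono)
        have "(\<Sum>i=1..n. d i * r ^ i) \<le> (\<Sum>n. d n * r ^ n)"
          by (rule sum_le_suminf) (use r d_nonneg summ in auto)
        then show "(\<Sum>i=1..n. d i * r ^ i) \<le> 1" using r by simp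
      qed (use \<rho> in auto)
      finally show ?thesis using nonneg by simp
    qed (simp add: C0)
  qed
  \<comment> \<open>A coefficient of \<open>P\<close> is a difference of successive tails, hence at
    most the earlier one; this is where the exponent \<open>n - 1\<close> comes from.\<close>
  have "fps_nth P n \<le> \<rho> ^ (n - 1)" for n
  proof (cases n)
    case (Suc m)
    have "fps_nth P n = fps_nth C m - fps_nth C n" using CSuc[of m] Suc by simp
    then show ?thesis using Cb[of m] Cb[of n] Suc by simp
  qed (simp add: p0)
  then show "\<exists>\<rho>. 0 < \<rho> \<and> \<rho> < 1 \<and> (\<forall>n. fps_nth P n \<le> \<rho> ^ (n - 1))"
    using \<rho> by blast
  have "(\<lambda>n. \<rho> ^ n) \<longlonglongrightarrow> 0" using \<rho> by (intro LIMSEQ_power_zero) auto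
  then have "fps_nth C \<longlonglongrightarrow> 0"
    by (rule tendsto_sandwich[rotated -1, where f = "\<lambda>_. 0"]) (use Cb in auto)
  then have "(\<lambda>n. 1 - fps_nth C n) \<longlonglongrightarrow> 1 - 0" by (intro tendsto_intros)
  then have "(\<lambda>n. \<Sum>k<Suc n. fps_nth P k) \<longlonglongrightarrow> 1" by (simp only: Csum zero_less_Suc) simp
  then show "fps_nth P sums 1"
    unfolding sums_def by (rule iffD1[OF filterlim_sequentially_Suc])
qed

text \<open>Differentiating the geometric series twice gives coefficients
  \<open>(n + 1) * (n + 2)\<close>, which dominate \<open>(n + 1)\<^sup>2\<close>.\<close>

lemma summable_square_power:
  fixes \<rho> :: real
  assumes "0 < \<rho>" "\<rho> < 1"
  shows "summable (\<lambda>n. (real n)\<^sup>2 * \<rho> ^ (n - 1))"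
proof -
  have "summable (\<lambda>n. \<rho> ^ n)" if "\<bar>\<rho>\<bar> < 1" for \<rho> :: real using that by (simp add: summable_geometric)
  then have s: "summable (\<lambda>n. diffs (\<lambda>n. 1) n * x ^ n)" if "\<bar>x\<bar> < 1" for x :: real
    by (intro termdiff_converges[of _ 1]) (use that in auto)
  have s2: "summable (\<lambda>n. diffs (diffs (\<lambda>n. 1 :: real)) n * \<rho> ^ n)"
    by (rule termdiff_converges[of _ 1]) (use assms s in auto)
  have "summable (\<lambda>n. (real (Suc n))\<^sup>2 * \<rho> ^ n)"
  proof (rule summable_comparison_test[OF _ s2])
    show "\<exists>N. \<forall>n\<ge>N. norm ((real (Suc n))\<^sup>2 * \<rho> ^ n) \<le> diffs (diffs (\<lambda>n. 1)) n * \<rho> ^ n"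
    proof (intro exI[of _ 0] allI impI)
      fix n :: nat
      have "(real (Suc n))\<^sup>2 * \<rho> ^ n \<le> (real (Suc n) * real (Suc (Suc n))) * \<rho> ^ n"
        unfolding power2_eq_square by (intro mult_right_mono mult_left_mono) (use assms in auto)
      then show "norm ((real (Suc n))\<^sup>2 * \<rho> ^ n) \<le> diffs (diffs (\<lambda>n. 1)) n * \<rho> ^ n"
        using assms by (simp add: diffs_def)
    qed
  qed
  then show ?thesis
    by (subst summable_Suc_iff[symmetric]) simp
qed

text \<open>Finiteness of the second moment of the excursion size; this series dominates those of
  all statistics of at most quadratic growth.\<close>

lemma renewal_square_summable:
  fixes P :: "real fps"
  assumes q: "0 < q" "q < 1"
    and ren: "Abs_fps (qprod q) = 1 + P * Abs_fps (qprod q)"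
    and pos: "\<And>n. fps_nth P n \<ge> 0"
  shows "summable (\<lambda>n. (real n)\<^sup>2 * fps_nth P n)"
proof -
  obtain \<rho> where \<rho>: "0 < \<rho>" "\<rho> < 1" "\<And>n. fps_nth P n \<le> \<rho> ^ (n - 1)"
    using renewal_exponential_tail(1)[OF q ren pos] by blast
  show ?thesis
    by (rule summable_comparison_test[OF _ summable_square_power[OF \<rho>(1,2)]])
       (use pos \<rho>(3) in \<open>auto intro!: exI[of _ 0] mult_left_mono\<close>)
qed

text \<open>With \<open>A = B / (1 - z)\<close> and \<open>B\<close> absolutely summable to
  \<open>\<alpha>\<close>, the series \<open>A * A * G\<close> is \<open>B * B * G\<close> over
  \<open>(1 - z)\<^sup>2\<close>, so its coefficients are asymptotically
  \<open>\<alpha>\<^sup>2 * n\<close> times the sum of \<open>G\<close>, up to \<open>o(n)\<close>.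
  The \<open>c\<close> term has bounded coefficients and \<open>c'\<close> is constant, so both
  vanish after division by \<open>n\<close>; dividing by \<open>qprod q n\<close> removes one
  \<open>\<alpha>\<close>.\<close>

lemma renewal_second_moment_asymptotics:
  fixes P G F :: "real fps" and c c' :: real
  assumes q: "0 < q" "q < 1" and lim: "qprod q \<longlonglongrightarrow> \<alpha>" and \<alpha>: "\<alpha> > 0"
    and ren: "Abs_fps (qprod q) = 1 + P * Abs_fps (qprod q)"
    and pos: "\<And>n. fps_nth P n \<ge> 0"
    and G: "\<And>n. \<bar>fps_nth G n\<bar> \<le> (real n)\<^sup>2 * fps_nth P n"
    and F: "F = Abs_fps (qprod q) * Abs_fps (qprod q) * G + fps_const c * (Abs_fps (qprod q) - 1 - P)"
  shows "(\<lambda>n. (fps_nth F n / qprod q n - c') / real n) \<longlonglongrightarrow> \<alpha> * (\<Sum>n. fps_nth G n)"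
proof -
  let ?A = "Abs_fps (qprod q)"
  have summ: "summable (\<lambda>n. \<bar>fps_nth G n\<bar>)"
    by (rule summable_comparison_test[OF _ renewal_square_summable[OF q ren pos]]) (use G in auto)
  define \<sigma> where "\<sigma> = (\<Sum>n. fps_nth G n)"
  have absG: "abs_sums G \<sigma>"
    using summ unfolding abs_sums_def \<sigma>_def by (auto intro: summable_sums summable_rabs_cancel)
  define b where "b k = (case k of 0 \<Rightarrow> 1 | Suc m \<Rightarrow> - qprod q m * q ^ k)" for k
  define B where "B = Abs_fps b"
  have bsum: "(\<Sum>k<Suc n. b k) = qprod q n" for n
    by (induction n) (simp_all add: b_def qprod_Suc algebra_simps)
  have AB: "?A = B * fps_ones"
    by (rule fps_ext) (simp only: nth_mult_ones B_def fps_nth_Abs_fps bsum lessThan_Suc_atMost[symmetric])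
  have "norm (b k) \<le> q ^ k" for k
    using qprod_bounds[OF q] q
    by (cases k) (auto simp: b_def abs_mult abs_of_pos intro!: mult_left_le_one_le)
  then have "summable (\<lambda>k. \<bar>b k\<bar>)"
    by (intro summable_comparison_test[of "\<lambda>k. \<bar>b k\<bar>" "\<lambda>k. q ^ k"])
       (use q in \<open>auto simp: summable_geometric\<close>)
  moreover have "b sums \<alpha>"
    unfolding sums_def by (rule iffD1[OF filterlim_sequentially_Suc]) (simp only: bsum lim)
  moreover have "fps_nth B = b"
    by (rule ext) (simp add: B_def)
  ultimately have absB: "abs_sums B \<alpha>"
    by (simp add: abs_sums_def)
  define H where "H = B * B * G"
  have "abs_sums H (\<alpha> * \<alpha> * \<sigma>)"
    unfolding H_def by (intro abs_sums_mult absB absG)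
  then have "(\<lambda>n. fps_nth (H * fps_ones * fps_ones) n / real n) \<longlonglongrightarrow> \<alpha> * \<alpha> * \<sigma>"
    by (rule abs_sums_ones_ones)
  moreover have "H * fps_ones * fps_ones = ?A * ?A * G"
    by (simp add: AB H_def mult_ac)
  ultimately have main: "(\<lambda>n. fps_nth (?A * ?A * G) n / real n) \<longlonglongrightarrow> \<alpha> * \<alpha> * \<sigma>"
    by simp
  have inv_n: "(\<lambda>n. 1 / real n) \<longlonglongrightarrow> 0" by (rule lim_1_over_n)
  have "fps_nth P \<longlonglongrightarrow> 0"
    using renewal_exponential_tail(2)[OF q ren pos] by (metis sums_summable summable_LIMSEQ_zero)
  then have "(\<lambda>n. (fps_nth (?A * ?A * G) n / real n
      + c * (qprod q n - (if n = 0 then 1 else 0) - fps_nth P n) * (1 / real n)) / qprod q n - c' * (1 / real n))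
      \<longlonglongrightarrow> (\<alpha> * \<alpha> * \<sigma> + c * (\<alpha> - 0 - 0) * 0) / \<alpha> - c' * 0"
    using \<alpha> by (intro tendsto_intros main lim inv_n)
       (auto intro!: tendsto_eventually eventually_mono[OF eventually_gt_at_top[of "0::nat"]])
  \<comment> \<open>This includes \<open>n = 0\<close>, where both sides are \<open>0\<close>
    because division by \<open>0\<close> yields \<open>0\<close>.\<close>
  moreover have "(fps_nth F n / qprod q n - c') / real n = (fps_nth (?A * ?A * G) n / real n
      + c * (qprod q n - (if n = 0 then 1 else 0) - fps_nth P n) * (1 / real n)) / qprod q n - c' * (1 / real n)" for n
    using qprod_bounds(1)[OF q, of n]
    by (simp add: F divide_simps)
  ultimately show "(\<lambda>n. (fps_nth F n / qprod q n - c') / real n) \<longlonglongrightarrow> \<alpha> * (\<Sum>n. fps_nth G n)"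
    using \<alpha> by (simp add: \<sigma>_def)
qed

subsection \<open>Inversions and descents\<close>

lemma perm_inversions_0 [simp]: "perm_inversions 0 u = 0"
  by (auto simp: perm_inversions_def card_eq_0_iff)

text \<open>Exchanging the entries at an ascent creates the single inversion
  \<open>(i, Suc i)\<close>; every other inversion is carried along by renaming positions.\<close>

lemma perm_inversions_swap:
  assumes "1 \<le> i" "i < n" "u i < u (Suc i)"
  shows "perm_inversions n (u \<circ> Transposition.transpose i (Suc i)) = Suc (perm_inversions n u)"
proof -
  let ?s = "Transposition.transpose i (Suc i)"
  let ?I = "\<lambda>u. {(i, j). 1 \<le> i \<and> i < j \<and> j \<le> n \<and> u i > (u j :: nat)}"
  let ?f = "\<lambda>(a, b). (?s a, ?s b)"
  have fin: "finite (?I u)"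
    by (rule finite_subset[of _ "{..n} \<times> {..n}"]) auto
  have "(a, b) \<in> ?I (u \<circ> ?s) \<longleftrightarrow> (a, b) = (i, Suc i) \<or> (?s a, ?s b) \<in> ?I u" for a b
    using assms by (auto simp: Transposition.transpose_def split: if_splits)
  moreover have "(?s a, ?s b) \<in> ?I u \<longleftrightarrow> (a, b) \<in> ?f ` ?I u" for a b
  proof
    assume "(?s a, ?s b) \<in> ?I u"
    then show "(a, b) \<in> ?f ` ?I u" by (intro image_eqI[of _ _ "(?s a, ?s b)"]) simp_all
  next
    assume "(a, b) \<in> ?f ` ?I u"
    then obtain c d where "(c, d) \<in> ?I u" "(a, b) = (?s c, ?s d)" by auto
    then show "(?s a, ?s b) \<in> ?I u" by simp
  qed
  ultimately have eq: "?I (u \<circ> ?s) = insert (i, Suc i) (?f ` ?I u)" by auto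
  have "inj_on ?f (?I u)"
    by (rule inj_onI) (auto simp: inj_eq[OF inj_on_transpose] dest: transpose_eq_imp_eq)
  moreover have "(i, Suc i) \<notin> ?f ` ?I u"
    using assms(3) by (auto simp: Transposition.transpose_def split: if_splits)
  ultimately show ?thesis
    unfolding perm_inversions_def eq using fin by (simp add: card_image)
qed

text \<open>Positions and values trade roles: an inversion \<open>(i, j)\<close> of \<open>u\<close>
  becomes the inversion \<open>(u j, u i)\<close> of \<open>inv u\<close>.\<close>

lemma perm_inversions_inv:
  assumes "u permutes {1..n}"
  shows "perm_inversions n (inv u) = perm_inversions n u"
proof -
  let ?I = "\<lambda>u. {(i, j). 1 \<le> i \<and> i < j \<and> j \<le> n \<and> u i > (u j :: nat)}"
  note u = permutes_inverses[OF assms] permutes_in_image[OF assms]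
  note u' = permutes_in_image[OF permutes_inv[OF assms]]
  have "bij_betw (\<lambda>(i, j). (u j, u i)) (?I u) (?I (inv u))"
  proof (rule bij_betw_byWitness[where f' = "\<lambda>(i, j). (inv u j, inv u i)"])
    have "1 \<le> u j \<and> u i \<le> n" if "1 \<le> i" "i < j" "j \<le> n" for i j
      using u(3)[of i] u(3)[of j] that by auto
    then show "(\<lambda>(i, j). (u j, u i)) ` ?I u \<subseteq> ?I (inv u)" using u(1,2) by auto
    have "1 \<le> inv u j \<and> inv u i \<le> n" if "1 \<le> i" "i < j" "j \<le> n" for i j
      using u'[of i] u'[of j] that by auto
    then show "(\<lambda>(i, j). (inv u j, inv u i)) ` ?I (inv u) \<subseteq> ?I u" using u(1,2) by auto
  qed (use u(1,2) in auto)
  then show ?thesis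
    unfolding perm_inversions_def by (simp add: bij_betw_same_card)
qed

text \<open>Composition with the adjacent transposition matches the \<open>P\<close> permutations
  with the \<open>Q\<close> ones and raises the inversion number by one. This serves both the
  recursion for \<open>mallows_weight\<close> and the probability of a descent.\<close>

lemma sum_swap:
  fixes q :: real
  assumes i: "1 \<le> i" "i < n"
    and P: "\<And>u. u permutes {1..n} \<Longrightarrow> P u \<longleftrightarrow> Q (u \<circ> Transposition.transpose i (Suc i))"
    and Q: "\<And>u. u permutes {1..n} \<Longrightarrow> Q u \<Longrightarrow> u (Suc i) < u i"
  shows "(\<Sum>u | u permutes {1..n} \<and> Q u. q ^ perm_inversions n u)
       = q * (\<Sum>u | u permutes {1..n} \<and> P u. q ^ perm_inversions n u)"
proof -
  let ?s = "Transposition.transpose i (Suc i)"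
  have s: "?s permutes {1..n}" using i by (intro permutes_swap_id) auto
  have ss: "u \<circ> ?s \<circ> ?s = u" for u :: "nat \<Rightarrow> nat" by (simp add: comp_assoc)
  have inversions: "q ^ perm_inversions n (u \<circ> ?s) = q * q ^ perm_inversions n u"
    if "u permutes {1..n}" "P u" for u
  proof -
    have "(u \<circ> ?s) (Suc i) < (u \<circ> ?s) i"
      using that P Q permutes_compose[OF s that(1)] by blast
    then show ?thesis using perm_inversions_swap[OF i, of u] by simp
  qed
  have PQ: "P (u \<circ> ?s)" if "u permutes {1..n}" "Q u" for u
    using P[OF permutes_compose[OF s that(1)]] that ss by simp
  show ?thesis
    unfolding sum_distrib_left
    by (rule sum.reindex_bij_witness[where i = "\<lambda>u. u \<circ> ?s" and j = "\<lambda>u. u \<circ> ?s"])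
       (use ss PQ P permutes_compose[OF s] inversions[OF permutes_compose[OF s] PQ]
         in \<open>auto simp: comp_assoc\<close>)
qed

text \<open>The sum is split by the position of the largest value: moving that value one place to
  the left multiplies the weight by \<open>q\<close>, and in last position it can be
  deleted.\<close>

lemma mallows_weight_Suc: "mallows_weight q (Suc n) = mallows_weight q n * (\<Sum>k\<le>n. q ^ k)"
proof -
  define Z where "Z k = (\<Sum>u | u permutes {1..Suc n} \<and> u k = Suc n. q ^ perm_inversions (Suc n) u)" for k
  have last: "Z (Suc n) = mallows_weight q n"
  proof -
    have "{u. u permutes {1..Suc n} \<and> u (Suc n) = Suc n} = {u. u permutes {1..n}}"
    proof (intro set_eqI iffI CollectI conjI)
      fix u assume "u \<in> {u. u permutes {1..Suc n} \<and> u (Suc n) = Suc n}"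
      then show "u permutes {1..n}"
        by (intro permutes_superset[of u "{1..Suc n}" "{1..n}"]) (auto simp: le_Suc_eq)
    next
      fix u assume "u \<in> {u. u permutes {1..n}}"
      then have u: "u permutes {1..n}" by simp
      show "u permutes {1..Suc n}" by (rule permutes_subset[OF u]) auto
      show "u (Suc n) = Suc n" using permutes_not_in[OF u, of "Suc n"] by simp
    qed
    moreover have "perm_inversions (Suc n) u = perm_inversions n u" if "u permutes {1..n}" for u
    proof -
      have "u i \<le> Suc n" if "i \<le> Suc n" for i
        using permutes_in_image[OF \<open>u permutes _\<close>, of i] permutes_not_in[OF \<open>u permutes _\<close>, of i] that
        by (cases "i \<in> {1..n}") auto
      moreover have "u (Suc n) = Suc n" using permutes_not_in[OF that, of "Suc n"] by simp
      ultimately have "j \<le> n" if "i < j" "j \<le> Suc n" "u j < u i" for i j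
        using that by (metis le_Suc_eq less_imp_le not_less order.trans)
      then have "{(i, j). 1 \<le> i \<and> i < j \<and> j \<le> Suc n \<and> u j < u i}
          = {(i, j). 1 \<le> i \<and> i < j \<and> j \<le> n \<and> u j < u i}"
        by auto
      then show ?thesis by (simp add: perm_inversions_def)
    qed
    ultimately show ?thesis by (simp add: Z_def mallows_weight_def)
  qed
  have step: "Z k = q * Z (Suc k)" if "1 \<le> k" "k < Suc n" for k
    unfolding Z_def
  proof (rule sum_swap[OF that])
    fix u assume u: "u permutes {1..Suc n}" "u k = Suc n"
    then have "u (Suc k) \<le> Suc n" "u (Suc k) \<noteq> u k"
      using permutes_in_image[OF u(1), of "Suc k"] that inj_eq[OF permutes_inj[OF u(1)], of "Suc k" k]
      by auto
    then show "u (Suc k) < u k" using u by simp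
  qed simp
  have pow: "Z (Suc n - k) = q ^ k * mallows_weight q n" if "k \<le> n" for k
    using that
  proof (induction k)
    case (Suc k)
    then show ?case using step[of "n - k"] by (simp add: Suc_diff_le)
  qed (simp add: last)
  have "mallows_weight q (Suc n) = (\<Sum>k=1..Suc n. Z k)"
  proof -
    have "{u. u permutes {1..Suc n}} = (\<Union>k\<in>{1..Suc n}. {u. u permutes {1..Suc n} \<and> u k = Suc n})"
    proof -
      have "\<exists>k\<in>{1..Suc n}. u k = Suc n" if "u permutes {1..Suc n}" for u
        using permutes_image[OF that] by (metis atLeastAtMost_iff image_iff le_refl le_add1 plus_1_eq_Suc)
      then show ?thesis by auto
    qed
    moreover have "finite {u. u permutes {1..Suc n} \<and> u k = Suc n}" for k
      by (rule finite_subset[OF _ finite_permutations[of "{1..Suc n}"]]) auto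
    moreover have "{u. u permutes {1..Suc n} \<and> u j = Suc n} \<inter> {u. u permutes {1..Suc n} \<and> u k = Suc n} = {}"
      if "j \<noteq> k" for j k
    proof -
      have "j = k" if "u permutes {1..Suc n}" "u j = Suc n" "u k = Suc n" for u
        using that(2,3) inj_eq[OF permutes_inj[OF that(1)], of j k] by simp
      then show ?thesis using \<open>j \<noteq> k\<close> by auto
    qed
    ultimately show ?thesis
      unfolding mallows_weight_def Z_def
      by (subst sum.UNION_disjoint[symmetric]) (simp_all del: One_nat_def)
  qed
  also have "\<dots> = (\<Sum>k\<le>n. Z (Suc n - k))"
    by (rule sum.reindex_bij_witness[where i = "\<lambda>k. Suc n - k" and j = "\<lambda>k. Suc n - k"]) auto
  also have "\<dots> = (\<Sum>k\<le>n. q ^ k * mallows_weight q n)"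
    by (rule sum.cong) (simp_all add: pow)
  finally show ?thesis by (simp add: sum_distrib_left mult.commute)
qed

text \<open>
  The probability that the first \<open>n\<close> values of the Mallows process are \<open>u(1), \<dots>, u(n)\<close>;
  see \<open>mallows_process_cylinder\<close> below.
\<close>

definition excursion_weight :: "real \<Rightarrow> nat \<Rightarrow> (nat \<Rightarrow> nat) \<Rightarrow> real" where
  "excursion_weight q n u = (1 - q) ^ n * q ^ perm_inversions n u"

lemma qprod_eq_mallows_weight: "qprod q n = (1 - q) ^ n * mallows_weight q n"
proof (induction n)
  case 0
  show ?case by (simp add: mallows_weight_def)
next
  case (Suc n)
  have "1 - q ^ Suc n = (1 - q) * (\<Sum>k\<le>n. q ^ k)"
    by (simp only: one_diff_power_eq lessThan_Suc_atMost)
  then show ?case by (simp only: qprod_Suc Suc mallows_weight_Suc) (simp add: mult_ac)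
qed

text \<open>Together with \<open>mallows_process_cylinder\<close> this makes
  \<open>qprod q n\<close> the probability that the first \<open>n\<close> values of the process
  permute \<open>{1..n}\<close>.\<close>

lemma sum_excursion_weight: "(\<Sum>u | u permutes {1..n}. excursion_weight q n u) = qprod q n"
  by (simp add: excursion_weight_def qprod_eq_mallows_weight mallows_weight_def sum_distrib_left)

lemma des_eq_sum: "real (des n u) = (\<Sum>i\<in>{1..<n}. of_bool (u (Suc i) < u i))"
  by (simp add: des_def of_bool_def sum.If_cases Int_def)

text \<open>Exchanging the entries at \<open>i\<close> and \<open>Suc i\<close> pairs ascents with
  descents at weight ratio \<open>q\<close>, so each of the \<open>n - 1\<close> positions carries a
  descent with Mallows probability \<open>q / (1 + q)\<close>.\<close>

lemma sum_excursion_weight_des: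
  assumes "q > 0"
  shows "(\<Sum>u | u permutes {1..n}. excursion_weight q n u * real (des n u))
    = qprod q n * (real (n - 1) * (q / (1 + q)))"
proof -
  have fin: "finite {u. u permutes {1..n}}" by (simp add: finite_permutations)
  have des: "(\<Sum>u | u permutes {1..n} \<and> u (Suc i) < u i. q ^ perm_inversions n u)
    = q / (1 + q) * mallows_weight q n" (is "?D = _") if i: "1 \<le> i" "i < n" for i
  proof -
    have "?D = q * (\<Sum>u | u permutes {1..n} \<and> \<not> u (Suc i) < u i. q ^ perm_inversions n u)"
    proof (rule sum_swap[OF i])
      fix u assume "u permutes {1..n}"
      then have "u i \<noteq> u (Suc i)" using inj_eq[OF permutes_inj] by fastforce
      then show "(\<not> u (Suc i) < u i) \<longleftrightarrow>
          (u \<circ> Transposition.transpose i (Suc i)) (Suc i) < (u \<circ> Transposition.transpose i (Suc i)) i"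
        by auto
    qed
    moreover have "mallows_weight q n
      = ?D + (\<Sum>u | u permutes {1..n} \<and> \<not> u (Suc i) < u i. q ^ perm_inversions n u)"
      unfolding mallows_weight_def
      using sum.Int_Diff[OF fin, of _ "{u. u (Suc i) < u i}"]
      by (simp add: Collect_conj_eq set_diff_eq Collect_neg_eq)
    ultimately show ?thesis using assms by (simp add: field_simps)
  qed
  have "(\<Sum>u | u permutes {1..n}. excursion_weight q n u * real (des n u))
    = (\<Sum>i\<in>{1..<n}. (1 - q) ^ n * (\<Sum>u | u permutes {1..n} \<and> u (Suc i) < u i. q ^ perm_inversions n u))"
    unfolding des_eq_sum sum_distrib_left excursion_weight_def
    by (subst sum.swap, rule sum.cong[OF refl], rule sum.mono_neutral_cong_right[OF fin]) auto
  also have "\<dots> = (\<Sum>i\<in>{1..<n}. (1 - q) ^ n * (q / (1 + q) * mallows_weight q n))"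
    by (rule sum.cong[OF refl], subst des) auto
  finally show ?thesis by (simp add: qprod_eq_mallows_weight)
qed

lemma sum_inv_permutes:
  "(\<Sum>u | u permutes {1..n}. excursion_weight q n u * f (inv u))
    = (\<Sum>u | u permutes {1..n}. excursion_weight q n u * (f u :: real))"
  by (rule sum.reindex_bij_witness[where i = inv and j = inv])
     (auto simp: excursion_weight_def perm_inversions_inv permutes_inv permutes_inv_inv)

subsection \<open>Direct sums and regeneration times\<close>

definition perm_sum :: "nat \<Rightarrow> (nat \<Rightarrow> nat) \<Rightarrow> (nat \<Rightarrow> nat) \<Rightarrow> nat \<Rightarrow> nat" where
  "perm_sum m u v i = (if i \<le> m then u i else m + v (i - m))"

lemma permutes_le_iff:
  fixes n :: nat
  assumes "u permutes {1..n}"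
  shows "u i \<le> n \<longleftrightarrow> i \<le> n" and "u i = 0 \<longleftrightarrow> i = 0"
  using permutes_in_image[OF assms, of i] permutes_not_in[OF assms, of i]
  by (cases "i \<in> {1..n}"; auto)+

lemma permutes_atLeast1I:
  fixes n :: nat
  assumes "inj_on u {1..n}" "\<And>i. 1 \<le> i \<Longrightarrow> i \<le> n \<Longrightarrow> 1 \<le> u i \<and> u i \<le> n" "u 0 = 0"
    and "\<And>i. i > n \<Longrightarrow> u i = i"
  shows "u permutes {1..n}"
proof (rule bij_imp_permutes)
  have "u ` {1..n} \<subseteq> {1..n}" using assms(2) by auto
  then show "bij_betw u {1..n} {1..n}"
    using assms(1) endo_inj_surj[of "{1..n}" u] by (auto simp: bij_betw_def)
  show "u x = x" if "x \<notin> {1..n}" for x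
    using that assms(3) assms(4)[of x] by (cases "x = 0") auto
qed

lemma perm_sum_perm_sum:
  assumes "u permutes {1..m}" "v permutes {1..k}"
  shows "perm_sum m u' v' (perm_sum m u v i) = perm_sum m (u' \<circ> u) (v' \<circ> v) i"
  using permutes_le_iff[OF assms(1), of i] permutes_le_iff[OF assms(2), of "i - m"]
  by (auto simp: perm_sum_def)

lemma perm_sum_inverses:
  assumes "u permutes {1..m}" "v permutes {1..k}"
  shows "perm_sum m (inv u) (inv v) (perm_sum m u v i) = i" "perm_sum m u v (perm_sum m (inv u) (inv v) i) = i"
  using perm_sum_perm_sum[OF assms] perm_sum_perm_sum[OF permutes_inv[OF assms(1)] permutes_inv[OF assms(2)]]
    permutes_inv_o[OF assms(1)] permutes_inv_o[OF assms(2)]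
  by (auto simp: perm_sum_def)

lemma inv_perm_sum:
  assumes "u permutes {1..m}" "v permutes {1..k}"
  shows "inv (perm_sum m u v) = perm_sum m (inv u) (inv v)"
  by (rule inv_unique_comp) (auto simp: fun_eq_iff perm_sum_inverses[OF assms])

lemma perm_sum_permutes:
  assumes "u permutes {1..m}" "v permutes {1..k}"
  shows "perm_sum m u v permutes {1..m + k}"
proof (rule permutes_atLeast1I)
  show "inj_on (perm_sum m u v) {1..m + k}"
    by (rule inj_on_inverseI) (rule perm_sum_inverses[OF assms])
  fix i assume i: "1 \<le> i" "i \<le> m + k"
  show "1 \<le> perm_sum m u v i \<and> perm_sum m u v i \<le> m + k"
    using i permutes_le_iff[OF assms(1), of i] permutes_le_iff[OF assms(2), of "i - m"]
    by (cases "i \<le> m") (auto simp: perm_sum_def)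
next
  show "perm_sum m u v 0 = 0" using permutes_le_iff(2)[OF assms(1), of 0] by (simp add: perm_sum_def)
next
  fix i assume "i > m + k"
  moreover from this have "v (i - m) = i - m"
    by (intro permutes_not_in[OF assms(2)]) auto
  ultimately show "perm_sum m u v i = i"
    by (simp add: perm_sum_def)
qed

text \<open>Values of the first block are at most \<open>m\<close> and those of the second exceed
  \<open>m\<close>, so no inversion joins the two blocks.\<close>

lemma perm_inversions_perm_sum:
  assumes "u permutes {1..m}" "v permutes {1..k}"
  shows "perm_inversions (m + k) (perm_sum m u v) = perm_inversions m u + perm_inversions k v"
proof -
  let ?I = "\<lambda>n u. {(i, j). 1 \<le> i \<and> i < j \<and> j \<le> n \<and> u i > (u j :: nat)}"
  let ?f = "\<lambda>(i, j). (m + i, m + j)"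
  have fin: "finite (?I n u)" for n and u :: "nat \<Rightarrow> nat"
    by (rule finite_subset[of _ "{..n} \<times> {..n}"]) auto
  have "?I (m + k) (perm_sum m u v) = ?I m u \<union> ?f ` ?I k v"
  proof (intro set_eqI iffI)
    fix x assume x: "x \<in> ?I (m + k) (perm_sum m u v)"
    obtain i j where ij: "x = (i, j)" by fastforce
    consider "j \<le> m" | "i \<le> m" "m < j" | "m < i" by linarith
    then show "x \<in> ?I m u \<union> ?f ` ?I k v"
    proof cases
      case 1
      then show ?thesis using x ij by (auto simp: perm_sum_def)
    next
      case 2
      then show ?thesis using x ij permutes_le_iff(1)[OF assms(1), of i] by (auto simp: perm_sum_def)
    next
      case 3
      then have "(i - m, j - m) \<in> ?I k v" using x ij by (auto simp: perm_sum_def)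
      then show ?thesis using 3 x ij by (auto intro!: image_eqI[of _ _ "(i - m, j - m)"])
    qed
  qed (auto simp: perm_sum_def)
  moreover have "?I m u \<inter> ?f ` ?I k v = {}" by auto
  moreover have "inj_on ?f (?I k v)" by (auto simp: inj_on_def)
  ultimately show ?thesis
    unfolding perm_inversions_def using fin by (simp add: card_Un_disjoint card_image)
qed

text \<open>The junction \<open>m\<close> is no descent: the value there is at most \<open>m\<close>
  and the next is at least \<open>m\<close>. Hence additivity needs no boundary correction.\<close>

lemma des_perm_sum:
  assumes "u permutes {1..m}" "v permutes {1..k}"
  shows "des (m + k) (perm_sum m u v) = des m u + des k v"
proof -
  let ?D = "\<lambda>n u. {i \<in> {1..<n}. u i > (u (i + 1) :: nat)}"
  have "?D (m + k) (perm_sum m u v) = ?D m u \<union> (+) m ` ?D k v"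
  proof (intro set_eqI iffI)
    fix i assume i: "i \<in> ?D (m + k) (perm_sum m u v)"
    consider "i < m" | "i = m" | "m < i" by linarith
    then show "i \<in> ?D m u \<union> (+) m ` ?D k v"
    proof cases
      case 1
      then show ?thesis using i by (auto simp: perm_sum_def)
    next
      case 2
      then show ?thesis using i permutes_le_iff(1)[OF assms(1), of i] by (auto simp: perm_sum_def)
    next
      case 3
      then have "i - m \<in> ?D k v" using i by (auto simp: perm_sum_def Suc_diff_le)
      then show ?thesis using 3 by (auto intro!: image_eqI[of _ _ "i - m"])
    qed
  qed (auto simp: perm_sum_def)
  moreover have "?D m u \<inter> (+) m ` ?D k v = {}" by auto
  ultimately show ?thesis
    unfolding des_def by (simp add: card_Un_disjoint card_image)
qed

definition regeneration_count :: "nat \<Rightarrow> (nat \<Rightarrow> nat) \<Rightarrow> nat" where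
  "regeneration_count n s = card {i \<in> {1..n}. is_regeneration_time s i}"

text \<open>
  \<open>regeneration_perms 1 n\<close> consists of the possible excursions of size \<open>n\<close>: since \<open>n \<ge> 1\<close> is itself
  a regeneration time of a permutation of \<open>{1..n}\<close>, it is the only one.
\<close>

definition regeneration_perms :: "nat \<Rightarrow> nat \<Rightarrow> (nat \<Rightarrow> nat) set" where
  "regeneration_perms j n = {u. u permutes {1..n} \<and> regeneration_count n u = j}"

lemma finite_regeneration_perms: "finite (regeneration_perms j n)"
  by (rule finite_subset[OF _ finite_permutations[of "{1..n}"]]) (auto simp: regeneration_perms_def)

lemma is_regeneration_time_cong:
  assumes "\<And>i. 1 \<le> i \<Longrightarrow> i \<le> n \<Longrightarrow> s i = t i"
  shows "is_regeneration_time s n \<longleftrightarrow> is_regeneration_time t n"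
  using assms unfolding is_regeneration_time_def by auto

lemma is_regeneration_time_permutes:
  "u permutes {1..n} \<Longrightarrow> n \<ge> 1 \<Longrightarrow> is_regeneration_time u n"
  by (auto simp: is_regeneration_time_def permutes_le_iff)

lemma is_regeneration_time_perm_sum_le:
  "i \<le> m \<Longrightarrow> is_regeneration_time (perm_sum m u v) i \<longleftrightarrow> is_regeneration_time u i"
  by (rule is_regeneration_time_cong) (simp add: perm_sum_def)

lemma is_regeneration_time_perm_sum_plus:
  assumes "u permutes {1..m}" "i \<ge> 1"
  shows "is_regeneration_time (perm_sum m u v) (m + i) \<longleftrightarrow> is_regeneration_time v i"
proof
  assume L: "is_regeneration_time (perm_sum m u v) (m + i)"
  have "v j \<le> i" if "1 \<le> j" "j \<le> i" for j
  proof -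
    have "perm_sum m u v (m + j) \<le> m + i" using L that by (auto simp: is_regeneration_time_def)
    then show ?thesis using that by (simp add: perm_sum_def)
  qed
  then show "is_regeneration_time v i" using assms by (simp add: is_regeneration_time_def)
next
  assume R: "is_regeneration_time v i"
  have "perm_sum m u v j \<le> m + i" if "1 \<le> j" "j \<le> m + i" for j
  proof (cases "j \<le> m")
    case True
    then show ?thesis using permutes_le_iff(1)[OF assms(1), of j] by (simp add: perm_sum_def)
  next
    case False
    then have "j - m \<in> {1..i}" using that by auto
    then have "v (j - m) \<le> i" using R unfolding is_regeneration_time_def by blast
    then show ?thesis using False by (simp add: perm_sum_def)
  qed
  then show "is_regeneration_time (perm_sum m u v) (m + i)"
    using assms by (simp add: is_regeneration_time_def)
qed

lemma regeneration_count_perm_sum: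
  assumes "u permutes {1..m}"
  shows "regeneration_count (m + k) (perm_sum m u v) = regeneration_count m u + regeneration_count k v"
proof -
  let ?R = "\<lambda>n u. {i \<in> {1..n}. is_regeneration_time u i}"
  have "?R (m + k) (perm_sum m u v) = ?R m u \<union> (+) m ` ?R k v"
  proof (intro set_eqI iffI)
    fix i assume i: "i \<in> ?R (m + k) (perm_sum m u v)"
    show "i \<in> ?R m u \<union> (+) m ` ?R k v"
    proof (cases "i \<le> m")
      case True
      then show ?thesis using i by (auto simp: is_regeneration_time_perm_sum_le)
    next
      case False
      then have "i - m \<in> ?R k v"
        using i is_regeneration_time_perm_sum_plus[OF assms, of "i - m" v] by auto
      then show ?thesis using False by (auto intro!: image_eqI[of _ _ "i - m"])
    qed
  next
    fix i assume "i \<in> ?R m u \<union> (+) m ` ?R k v"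
    then show "i \<in> ?R (m + k) (perm_sum m u v)"
      by (auto simp: is_regeneration_time_perm_sum_le is_regeneration_time_perm_sum_plus[OF assms])
  qed
  moreover have "?R m u \<inter> (+) m ` ?R k v = {}" by auto
  ultimately show ?thesis
    unfolding regeneration_count_def by (simp add: card_Un_disjoint card_image)
qed

lemma regeneration_perms_1D:
  assumes "u \<in> regeneration_perms 1 m"
  shows "u permutes {1..m}" "m \<ge> 1" "is_regeneration_time u i \<Longrightarrow> i \<le> m \<Longrightarrow> i = m"
proof -
  show u: "u permutes {1..m}" using assms by (simp add: regeneration_perms_def)
  have c: "card {i \<in> {1..m}. is_regeneration_time u i} = 1"
    using assms by (simp add: regeneration_perms_def regeneration_count_def)
  then show m: "m \<ge> 1" by (cases m) auto
  obtain x where x: "{i \<in> {1..m}. is_regeneration_time u i} = {x}"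
    using c by (auto simp: card_1_singleton_iff)
  have mem: "i = x" if "is_regeneration_time u i" "i \<le> m" for i
  proof -
    have "i \<in> {i \<in> {1..m}. is_regeneration_time u i}"
      using that by (simp add: is_regeneration_time_def)
    then show ?thesis unfolding x by simp
  qed
  show "is_regeneration_time u i \<Longrightarrow> i \<le> m \<Longrightarrow> i = m"
    using mem[of i] mem[of m] is_regeneration_time_permutes[OF u m] by simp
qed

text \<open>The cut is made at the first regeneration time \<open>m\<close>: the first
  \<open>m\<close> positions map onto \<open>{1..m}\<close>, the rest is again a permutation after
  shifting, and minimality of \<open>m\<close> makes the first block an excursion.\<close>

lemma perm_sum_decomposition:
  assumes "s permutes {1..n}" "n \<ge> 1"
  shows "\<exists>m\<in>{1..n}. \<exists>u\<in>regeneration_perms 1 m. \<exists>v. v permutes {1..n - m} \<and> s = perm_sum m u v"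
proof -
  define m where "m = (LEAST i. is_regeneration_time s i)"
  have n: "is_regeneration_time s n" using assms by (rule is_regeneration_time_permutes)
  then have m: "is_regeneration_time s m" "m \<le> n"
    unfolding m_def by (auto intro: LeastI Least_le)
  have m_least: "i \<ge> m" if "is_regeneration_time s i" for i
    using that unfolding m_def by (rule Least_le)
  have m1: "m \<ge> 1" using m by (simp add: is_regeneration_time_def)
  note inj = inj_eq[OF permutes_inj[OF assms(1)]]
  note s = permutes_le_iff[OF assms(1)]
  define u where "u i = (if i \<le> m then s i else i)" for i
  define v where "v i = s (m + i) - m" for i
  have sle: "s i \<le> m" if "i \<le> m" for i
    using that m s(2)[of i] by (cases "i = 0") (auto simp: is_regeneration_time_def)
  have u: "u permutes {1..m}"
  proof (rule permutes_atLeast1I)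
    show "inj_on u {1..m}" by (auto simp: inj_on_def u_def inj)
    show "1 \<le> u i \<and> u i \<le> m" if "1 \<le> i" "i \<le> m" for i
      using that sle[of i] s(2)[of i] by (auto simp: u_def)
  qed (use s in \<open>auto simp: u_def\<close>)
  \<comment> \<open>The first block already takes every value in \<open>{1..m}\<close>, so
    injectivity pushes all later values above \<open>m\<close>.\<close>
  have sgt: "s i > m" if "i > m" for i
  proof (rule ccontr)
    assume "\<not> s i > m"
    then have "s i \<in> u ` {1..m}" using s(2)[of i] that permutes_image[OF u] by auto
    then show False using that by (auto simp: u_def inj)
  qed
  have v: "v permutes {1..n - m}"
  proof (rule permutes_atLeast1I)
    show "inj_on v {1..n - m}"
    proof (rule inj_onI)
      fix i j assume "i \<in> {1..n - m}" "j \<in> {1..n - m}" "v i = v j"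
      then show "i = j" using sgt[of "m + i"] sgt[of "m + j"] inj[of "m + i" "m + j"]
        by (auto simp: v_def)
    qed
    show "1 \<le> v i \<and> v i \<le> n - m" if "1 \<le> i" "i \<le> n - m" for i
      using that sgt[of "m + i"] s(1)[of "m + i"] m by (auto simp: v_def)
    show "v i = i" if "i > n - m" for i
      using that permutes_not_in[OF assms(1), of "m + i"] m by (auto simp: v_def)
  qed (use sle[of m] in \<open>simp add: v_def\<close>)
  have "s = perm_sum m u v"
  proof
    fix i show "s i = perm_sum m u v i" using sgt[of i] by (auto simp: perm_sum_def u_def v_def)
  qed
  moreover have "{i \<in> {1..m}. is_regeneration_time u i} = {m}"
  proof -
    have "is_regeneration_time u i \<longleftrightarrow> is_regeneration_time s i" if "i \<le> m" for i
      by (rule is_regeneration_time_cong) (use that in \<open>auto simp: u_def\<close>)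
    then show ?thesis using m m1 m_least by fastforce
  qed
  then have "u \<in> regeneration_perms 1 m"
    using u by (simp add: regeneration_perms_def regeneration_count_def)
  ultimately show ?thesis
    using m m1 v by (intro bexI[of _ m] bexI[of _ u] exI[of _ v]) auto
qed

text \<open>The first summand has no regeneration time before its end, so \<open>m\<close> is the
  first regeneration time of the sum and is determined by it; \<open>u\<close> and \<open>v\<close>
  are then read off.\<close>

lemma perm_sum_unique:
  assumes "perm_sum m u v = perm_sum m' u' v'"
    and u: "u \<in> regeneration_perms 1 m" and u': "u' \<in> regeneration_perms 1 m'"
    and v: "v permutes {1..k}" and v': "v' permutes {1..k'}"
  shows "m = m'" "u = u'" "v = v'"
proof -
  have le: "m \<le> m'" if u: "u \<in> regeneration_perms 1 m" and u': "u' \<in> regeneration_perms 1 m'"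
    and eq: "perm_sum m u v = perm_sum m' u' v'" for m u m' u' and v v' :: "nat \<Rightarrow> nat"
  proof (rule ccontr)
    assume "\<not> m \<le> m'"
    have "is_regeneration_time u' m'"
      using regeneration_perms_1D[OF u'] by (intro is_regeneration_time_permutes)
    then have "is_regeneration_time u m'"
      using eq \<open>\<not> m \<le> m'\<close> is_regeneration_time_perm_sum_le[of m' m' u' v'] is_regeneration_time_perm_sum_le[of m' m u v]
      by simp
    then show False using regeneration_perms_1D(3)[OF u] \<open>\<not> m \<le> m'\<close> by fastforce
  qed
  show m: "m = m'" using le[OF u u' assms(1)] le[OF u' u assms(1)[symmetric]] by simp
  show "u = u'"
  proof
    fix i show "u i = u' i"
      using fun_cong[OF assms(1), of i] m regeneration_perms_1D(1)[OF u] regeneration_perms_1D(1)[OF u']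
      by (cases "i \<le> m") (auto simp: perm_sum_def permutes_not_in)
  qed
  show "v = v'"
  proof
    fix i show "v i = v' i"
      using fun_cong[OF assms(1), of "m + i"] m permutes_not_in[OF v, of 0] permutes_not_in[OF v', of 0]
      by (cases "i = 0") (auto simp: perm_sum_def)
  qed
qed

lemma sum_perm_sum_decomposition:
  fixes g :: "(nat \<Rightarrow> nat) \<Rightarrow> real"
  assumes "n \<ge> 1"
  shows "(\<Sum>s | s permutes {1..n}. g s) =
    (\<Sum>m=1..n. \<Sum>u\<in>regeneration_perms 1 m. \<Sum>v | v permutes {1..n - m}. g (perm_sum m u v))"
proof -
  let ?S = "SIGMA m:{1..n}. SIGMA u:regeneration_perms 1 m. {v. v permutes {1..n - m}}"
  have "bij_betw (\<lambda>(m, u, v). perm_sum m u v) ?S {s. s permutes {1..n}}"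
    unfolding bij_betw_def
  proof (intro conjI subset_antisym subsetI)
    show "inj_on (\<lambda>(m, u, v). perm_sum m u v) ?S"
    proof (rule inj_onI)
      fix x y assume x: "x \<in> ?S" and y: "y \<in> ?S"
        and eq: "(\<lambda>(m, u, v). perm_sum m u v) x = (\<lambda>(m, u, v). perm_sum m u v) y"
      obtain m u v m' u' v' where "x = (m, u, v)" "y = (m', u', v')" by (cases x, cases y) auto
      then show "x = y"
        using perm_sum_unique[of m u v m' u' v' "n - m" "n - m'"] x y eq by simp
    qed
  next
    fix s assume "s \<in> (\<lambda>(m, u, v). perm_sum m u v) ` ?S"
    then obtain m u v where "m \<in> {1..n}" "u \<in> regeneration_perms 1 m" "v permutes {1..n - m}"
      "s = perm_sum m u v" by auto
    then show "s \<in> {s. s permutes {1..n}}"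
      using perm_sum_permutes[of u m v "n - m"] regeneration_perms_1D(1)[of u m] by simp
  next
    fix s assume "s \<in> {s. s permutes {1..n}}"
    then obtain m u v where "m \<in> {1..n}" "u \<in> regeneration_perms 1 m" "v permutes {1..n - m}"
      "s = perm_sum m u v"
      using perm_sum_decomposition[of s n] assms by blast
    then show "s \<in> (\<lambda>(m, u, v). perm_sum m u v) ` ?S"
      by (intro image_eqI[of _ _ "(m, u, v)"]) simp_all
  qed
  then have "(\<Sum>s | s permutes {1..n}. g s) = (\<Sum>(m, u, v)\<in>?S. g (perm_sum m u v))"
    by (simp add: sum.reindex_bij_betw[symmetric] case_prod_unfold)
  also have "\<dots> = (\<Sum>m=1..n. \<Sum>u\<in>regeneration_perms 1 m. \<Sum>v | v permutes {1..n - m}. g (perm_sum m u v))"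
    by (simp add: sum.Sigma[symmetric] finite_regeneration_perms finite_permutations)
  finally show ?thesis .
qed

lemma excursion_weight_perm_sum:
  assumes "u permutes {1..m}" "v permutes {1..k}"
  shows "excursion_weight q (m + k) (perm_sum m u v) = excursion_weight q m u * excursion_weight q k v"
  by (simp add: excursion_weight_def perm_inversions_perm_sum[OF assms] power_add)

section \<open>Regeneration times and excursions as functions of finitely many initial
  values\<close>

lemma regeneration_count_cong:
  assumes "\<And>i. 1 \<le> i \<Longrightarrow> i \<le> n \<Longrightarrow> s i = t i"
  shows "regeneration_count n s = regeneration_count n t"
proof -
  have "is_regeneration_time s i \<longleftrightarrow> is_regeneration_time t i" if "i \<le> n" for i
    by (rule is_regeneration_time_cong) (use assms that in auto)
  then show ?thesis unfolding regeneration_count_def by (intro arg_cong[where f = card]) auto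
qed

text \<open>The recursion by \<open>LEAST\<close> is matched with counting by passing from
  \<open>n\<close> to the largest earlier regeneration time, whose count is one less.\<close>

lemma regeneration_time_eqI:
  assumes "regeneration_count n s = k" and "n = 0 \<or> is_regeneration_time s n"
  shows "regeneration_time s k = n"
  using assms
proof (induction k arbitrary: n)
  case 0
  have "n = 0"
  proof (rule ccontr)
    assume "n \<noteq> 0"
    then have "n \<in> {i \<in> {1..n}. is_regeneration_time s i}" using 0 by auto
    then show False using 0(1) by (auto simp: regeneration_count_def)
  qed
  then show ?case by simp
next
  case (Suc k)
  have "n \<noteq> 0" using Suc.prems(1) by (cases n) (auto simp: regeneration_count_def)
  then have n: "is_regeneration_time s n" "n \<ge> 1" using Suc.prems(2) by auto
  define R where "R = {i \<in> {1..<n}. is_regeneration_time s i}"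
  have "{i \<in> {1..n}. is_regeneration_time s i} = insert n R"
    using n unfolding R_def by auto
  moreover have "finite R" "n \<notin> R" by (auto simp: R_def)
  ultimately have card: "card R = k" using Suc.prems(1) by (simp add: regeneration_count_def)
  \<comment> \<open>The default \<open>0\<close>, when there is no earlier regeneration time, agrees
    with \<open>regeneration_time s 0 = 0\<close>.\<close>
  define n' where "n' = (if R = {} then 0 else Max R)"
  have le: "i \<le> n'" if "i \<in> R" for i using that \<open>finite R\<close> by (auto simp: n'_def)
  have n': "n' = 0 \<or> n' \<in> R" using \<open>finite R\<close> Max_in[of R] by (auto simp: n'_def)
  then have n'n: "n' < n" using n by (auto simp: R_def)
  have "{i \<in> {1..n'}. is_regeneration_time s i} = R"
    using le n'n by (auto simp: R_def)
  then have "regeneration_count n' s = k" using card by (simp add: regeneration_count_def)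
  then have time: "regeneration_time s k = n'"
    using Suc.IH[of n'] n' by (auto simp: R_def)
  have "(LEAST m. is_regeneration_time s m \<and> n' < m) = n"
  proof (rule Least_equality)
    fix m assume m: "is_regeneration_time s m \<and> n' < m"
    show "n \<le> m"
    proof (rule ccontr)
      assume "\<not> n \<le> m"
      then have "m \<in> R" using m by (auto simp: R_def is_regeneration_time_def)
      then show False using le[of m] m by simp
    qed
  qed (use n n'n in simp)
  then show ?case by (simp add: time)
qed

lemma regeneration_time_agree:
  assumes v: "v \<in> regeneration_perms k n" and eq: "\<And>i. 1 \<le> i \<Longrightarrow> i \<le> n \<Longrightarrow> s i = v i"
  shows "regeneration_time s k = n"
proof (rule regeneration_time_eqI)
  show "regeneration_count n s = k"
    using v regeneration_count_cong[OF eq] by (simp add: regeneration_perms_def)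
  have "is_regeneration_time s n" if "n \<noteq> 0"
    using v that is_regeneration_time_permutes[of v n] is_regeneration_time_cong[OF eq]
    by (simp add: regeneration_perms_def)
  then show "n = 0 \<or> is_regeneration_time s n" by blast
qed

lemma perm_sum_regeneration_perms:
  assumes "v \<in> regeneration_perms j r" "u \<in> regeneration_perms k m"
  shows "perm_sum r v u \<in> regeneration_perms (j + k) (r + m)"
  using assms perm_sum_permutes[of v r u m] regeneration_count_perm_sum[of v r m u]
  by (simp add: regeneration_perms_def)

text \<open>The history \<open>v\<close> fixes the start \<open>r\<close> of the block and
  \<open>u\<close> fixes its length. On the block \<open>s\<close> is \<open>u\<close> shifted by
  \<open>r\<close>, and taking ranks undoes the shift.\<close>

lemma excursion_agree:
  assumes v: "v \<in> regeneration_perms j r" and u: "u \<in> regeneration_perms 1 m"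
    and eq: "\<And>i. 1 \<le> i \<Longrightarrow> i \<le> r + m \<Longrightarrow> s i = perm_sum r v u i"
  shows "excursion s (Suc j) = u" "excursion_size s (Suc j) = m"
proof -
  have j: "regeneration_time s j = r"
    by (rule regeneration_time_agree[OF v]) (simp add: eq perm_sum_def)
  have Sj: "regeneration_time s (Suc j) = r + m"
    using regeneration_time_agree[OF perm_sum_regeneration_perms[OF v u] eq] by simp
  show size: "excursion_size s (Suc j) = m"
    unfolding excursion_size_def using j Sj by simp
  have u': "u permutes {1..m}" using u by (simp add: regeneration_perms_def)
  have s: "s (r + i) = r + u i" if "i \<in> {1..m}" for i
    using that by (simp add: eq perm_sum_def)
  show "excursion s (Suc j) = u"
  proof
    fix i
    show "excursion s (Suc j) i = u i"
    proof (cases "i \<in> {1..m}")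
      case True
      have "{l \<in> {1..m}. s (r + l) \<le> s (r + i)} = {l \<in> {1..m}. u l \<le> u i}"
        using s True by auto
      \<comment> \<open>Since \<open>u\<close> permutes \<open>{1..m}\<close>, the positions with
        value at most \<open>u i\<close> are the preimages of \<open>1, ..., u i\<close>; so the
        rank of \<open>u i\<close> is \<open>u i\<close> itself.\<close>
      also have "\<dots> = inv u ` {1..u i}"
      proof (intro set_eqI iffI)
        fix l assume "l \<in> {l \<in> {1..m}. u l \<le> u i}"
        then have "u l \<in> {1..u i}" using permutes_in_image[OF u', of l] by auto
        moreover have "l = inv u (u l)" using permutes_inverses(2)[OF u'] by simp
        ultimately show "l \<in> inv u ` {1..u i}" by blast
      next
        fix l assume "l \<in> inv u ` {1..u i}"
        then obtain x where x: "l = inv u x" "x \<in> {1..u i}" by blast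
        have "u i \<in> {1..m}" using True permutes_in_image[OF u', of i] by blast
        then have "x \<in> {1..m}" using x by auto
        then show "l \<in> {l \<in> {1..m}. u l \<le> u i}"
          using x permutes_inverses(1)[OF u'] permutes_in_image[OF permutes_inv[OF u'], of x] by auto
      qed
      finally have "card {l \<in> {1..m}. s (r + l) \<le> s (r + i)} = u i"
        using permutes_inj[OF permutes_inv[OF u']] by (simp add: card_image inj_on_subset[of _ UNIV])
      then show ?thesis
        using True unfolding excursion_def Let_def size by (simp add: j)
    next
      case False
      then show ?thesis
        using permutes_not_in[OF u' False] unfolding excursion_def Let_def size by (simp only: if_False)
    qed
  qed
qed

subsection \<open>Generating functions of block-additive statistics\<close>

definition permutation_fps :: "real \<Rightarrow> (nat \<Rightarrow> (nat \<Rightarrow> nat) \<Rightarrow> real) \<Rightarrow> real fps" where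
  "permutation_fps q f = Abs_fps (\<lambda>n. \<Sum>u | u permutes {1..n}. excursion_weight q n u * f n u)"

definition excursion_fps :: "real \<Rightarrow> (nat \<Rightarrow> (nat \<Rightarrow> nat) \<Rightarrow> real) \<Rightarrow> real fps" where
  "excursion_fps q f = Abs_fps (\<lambda>n. \<Sum>u\<in>regeneration_perms 1 n. excursion_weight q n u * f n u)"

text \<open>The sum over an excursion followed by an arbitrary permutation, before any factorisation
  of \<open>f\<close>. The range starts at \<open>m = 0\<close> to match the Cauchy product; that
  term vanishes, as no excursion is empty.\<close>

definition pair_fps ::
    "real \<Rightarrow> (nat \<Rightarrow> (nat \<Rightarrow> nat) \<Rightarrow> nat \<Rightarrow> (nat \<Rightarrow> nat) \<Rightarrow> real) \<Rightarrow> real fps" where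
  "pair_fps q f = Abs_fps (\<lambda>n. \<Sum>m=0..n. \<Sum>u\<in>regeneration_perms 1 m. \<Sum>v | v permutes {1..n - m}.
     excursion_weight q m u * excursion_weight q (n - m) v * f m u (n - m) v)"

lemma pair_fps_add:
  "pair_fps q (\<lambda>m u k v. f m u k v + g m u k v) = pair_fps q f + pair_fps q g"
  by (rule fps_ext) (simp add: pair_fps_def sum.distrib distrib_left)

lemma pair_fps_product:
  "pair_fps q (\<lambda>m u k v. f m u * g k v) = excursion_fps q f * permutation_fps q g"
proof (rule fps_ext)
  fix n
  show "fps_nth (pair_fps q (\<lambda>m u k v. f m u * g k v)) n
    = fps_nth (excursion_fps q f * permutation_fps q g) n"
    unfolding pair_fps_def fps_mult_nth excursion_fps_def permutation_fps_def fps_nth_Abs_fps sum_product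
    by (intro sum.cong refl) (simp add: mult_ac)
qed

text \<open>Unique decomposition handles every size \<open>n \<ge> 1\<close>; the constant term
  accounts for the empty permutation, which has no first excursion.\<close>

lemma permutation_fps_eq_pair_fps:
  assumes "\<And>m u k v. u \<in> regeneration_perms 1 m \<Longrightarrow> v permutes {1..k} \<Longrightarrow>
      f (m + k) (perm_sum m u v) = g m u k v"
  shows "permutation_fps q f = fps_const (f 0 id) + pair_fps q g"
proof (rule fps_ext)
  fix n
  have empty: "regeneration_perms 1 0 = {}" using regeneration_perms_1D(2)[of _ 0] by auto
  show "fps_nth (permutation_fps q f) n = fps_nth (fps_const (f 0 id) + pair_fps q g) n"
  proof (cases "n = 0")
    case True
    then show ?thesis
      by (simp add: permutation_fps_def pair_fps_def empty[simplified] excursion_weight_def)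
  next
    case False
    have "(\<Sum>s | s permutes {1..n}. excursion_weight q n s * f n s)
      = (\<Sum>m=1..n. \<Sum>u\<in>regeneration_perms 1 m. \<Sum>v | v permutes {1..n - m}.
           excursion_weight q n (perm_sum m u v) * f n (perm_sum m u v))"
      using False by (intro sum_perm_sum_decomposition) simp
    also have "\<dots> = (\<Sum>m=1..n. \<Sum>u\<in>regeneration_perms 1 m. \<Sum>v | v permutes {1..n - m}.
        excursion_weight q m u * excursion_weight q (n - m) v * g m u (n - m) v)"
    proof (intro sum.cong refl)
      fix m u v assume "m \<in> {1..n}" "u \<in> regeneration_perms 1 m" "v \<in> {v. v permutes {1..n - m}}"
      then have "m + (n - m) = n" "u \<in> regeneration_perms 1 m" "u permutes {1..m}" "v permutes {1..n - m}"
        by (auto simp: regeneration_perms_def)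
      then show "excursion_weight q n (perm_sum m u v) * f n (perm_sum m u v)
          = excursion_weight q m u * excursion_weight q (n - m) v * g m u (n - m) v"
        using excursion_weight_perm_sum[of u m v "n - m" q] assms[of u m v "n - m"] by simp
    qed
    finally show ?thesis
      using False
      by (simp add: permutation_fps_def pair_fps_def sum.atLeast_Suc_atMost[of 0] empty[simplified])
  qed
qed

definition block_additive :: "(nat \<Rightarrow> (nat \<Rightarrow> nat) \<Rightarrow> real) \<Rightarrow> bool" where
  "block_additive f \<longleftrightarrow> (\<forall>m u k v. u permutes {1..m} \<longrightarrow> v permutes {1..k} \<longrightarrow>
     f (m + k) (perm_sum m u v) = f m u + f k v)"

lemma permutation_fps_one: "permutation_fps q (\<lambda>_ _. 1) = Abs_fps (qprod q)"
  by (simp add: permutation_fps_def sum_excursion_weight del: One_nat_def)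

lemma block_additive_empty:
  assumes "block_additive f"
  shows "f 0 id = 0"
proof -
  have "perm_sum 0 id id = id" by (simp add: perm_sum_def fun_eq_iff)
  moreover have "f (0 + 0) (perm_sum 0 id id) = f 0 id + f 0 id"
    using assms permutes_id unfolding block_additive_def by blast
  ultimately show ?thesis by simp
qed

lemma permutation_fps_renewal:
  "permutation_fps q (\<lambda>_ _. 1) = 1 + excursion_fps q (\<lambda>_ _. 1) * permutation_fps q (\<lambda>_ _. 1)"
proof -
  \<comment> \<open>The constant is written \<open>1 * 1\<close> so that
    \<open>pair_fps_product\<close> can factor it.\<close>
  have eq: "permutation_fps q (\<lambda>_ _. 1) = fps_const 1 + pair_fps q (\<lambda>_ _ _ _. 1 * 1)"
    by (rule permutation_fps_eq_pair_fps) simp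
  show ?thesis by (rule trans[OF eq]) (simp only: pair_fps_product[of q "\<lambda>_ _. 1" "\<lambda>_ _. 1"] fps_const_1_eq_1)
qed

lemma permutation_fps_additive:
  assumes "block_additive f"
  shows "permutation_fps q f = excursion_fps q f * permutation_fps q (\<lambda>_ _. 1)
    + excursion_fps q (\<lambda>_ _. 1) * permutation_fps q f"
proof -
  have eq: "permutation_fps q f = fps_const (f 0 id) + pair_fps q (\<lambda>m u k v. f m u * 1 + 1 * f k v)"
    by (rule permutation_fps_eq_pair_fps) (use assms in \<open>simp add: block_additive_def regeneration_perms_def\<close>)
  show ?thesis
    by (rule trans[OF eq])
       (simp only: pair_fps_add pair_fps_product block_additive_empty[OF assms] fps_const_0_eq_0 add_0)
qed

text \<open>Expanding the product of two sums gives four terms, each a function of the excursion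
  times a function of the rest.\<close>

lemma permutation_fps_additive_product:
  assumes "block_additive f" "block_additive g"
  shows "permutation_fps q (\<lambda>n u. f n u * g n u) =
    excursion_fps q (\<lambda>n u. f n u * g n u) * permutation_fps q (\<lambda>_ _. 1)
    + excursion_fps q f * permutation_fps q g + excursion_fps q g * permutation_fps q f
    + excursion_fps q (\<lambda>_ _. 1) * permutation_fps q (\<lambda>n u. f n u * g n u)"
proof -
  have eq: "permutation_fps q (\<lambda>n u. f n u * g n u) = fps_const (f 0 id * g 0 id)
    + pair_fps q (\<lambda>m u k v. (f m u * g m u) * 1 + f m u * g k v + g m u * f k v + 1 * (f k v * g k v))"
    by (rule permutation_fps_eq_pair_fps)
       (use assms in \<open>simp add: block_additive_def regeneration_perms_def algebra_simps\<close>)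
  show ?thesis
    by (rule trans[OF eq])
       (simp only: pair_fps_add pair_fps_product block_additive_empty[OF assms(1)] mult_zero_left
          fps_const_0_eq_0 add_0)
qed

lemma excursion_weight_nonneg: "0 < q \<Longrightarrow> q < 1 \<Longrightarrow> excursion_weight q n u \<ge> 0"
  by (simp add: excursion_weight_def)

lemma excursion_fps_bound:
  assumes q: "0 < q" "q < 1" and "\<And>u. u permutes {1..n} \<Longrightarrow> \<bar>f n u\<bar> \<le> c"
  shows "\<bar>fps_nth (excursion_fps q f) n\<bar> \<le> c * fps_nth (excursion_fps q (\<lambda>_ _. 1)) n"
proof -
  have "\<bar>fps_nth (excursion_fps q f) n\<bar>
      \<le> (\<Sum>u\<in>regeneration_perms 1 n. \<bar>excursion_weight q n u * f n u\<bar>)"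
    by (simp add: excursion_fps_def sum_abs)
  also have "\<dots> \<le> (\<Sum>u\<in>regeneration_perms 1 n. c * excursion_weight q n u)"
  proof (rule sum_mono)
    fix u assume "u \<in> regeneration_perms 1 n"
    then have "\<bar>f n u\<bar> \<le> c" using assms(3) by (simp add: regeneration_perms_def)
    then show "\<bar>excursion_weight q n u * f n u\<bar> \<le> c * excursion_weight q n u"
      using excursion_weight_nonneg[OF q, of n u]
      by (simp add: abs_mult mult.commute[of c] mult_left_mono)
  qed
  finally show ?thesis by (simp add: excursion_fps_def sum_distrib_left)
qed

lemma excursion_fps_one_nonneg:
  "0 < q \<Longrightarrow> q < 1 \<Longrightarrow> fps_nth (excursion_fps q (\<lambda>_ _. 1)) n \<ge> 0"
  by (auto simp: excursion_fps_def intro!: sum_nonneg excursion_weight_nonneg)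

text \<open>As \<open>A * (1 - P) = 1\<close>, dividing by \<open>1 - P\<close> means multiplying by
  \<open>A\<close>, and the renewal equations are solved explicitly. The second claim yields mean
  zero over an excursion, because \<open>P\<close> has the value \<open>1\<close> at
  \<open>z = 1\<close>.\<close>

lemma permutation_fps_second_moment:
  fixes c :: real
  assumes add: "block_additive f" "block_additive g"
    and mean: "permutation_fps q f = fps_const (- c) * (permutation_fps q (\<lambda>_ _. 1) - 1)"
      "permutation_fps q g = fps_const (- c) * (permutation_fps q (\<lambda>_ _. 1) - 1)"
  defines "A \<equiv> permutation_fps q (\<lambda>_ _. 1)" and "P \<equiv> excursion_fps q (\<lambda>_ _. 1)"
  shows "permutation_fps q (\<lambda>n u. f n u * g n u) =
      A * A * excursion_fps q (\<lambda>n u. f n u * g n u) + fps_const (2 * c\<^sup>2) * (A - 1 - P)"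
    and "excursion_fps q f = fps_const (- c) * (P - P * P)"
proof -
  have A: "A = 1 + P * A"
    unfolding A_def P_def by (rule permutation_fps_renewal)
  have A0: "A \<noteq> 0" using A by auto
  have AP: "A * (1 - P) = 1" using A by (simp add: algebra_simps)
  \<comment> \<open>The first-moment equation gives
    \<open>A * excursion_fps q h = permutation_fps q h * (1 - P)\<close>, and
    \<open>(A - 1) * (1 - P) = P\<close>.\<close>
  have excursion: "A * excursion_fps q h = fps_const (- c) * P"
    if h: "block_additive h" "permutation_fps q h = fps_const (- c) * (A - 1)" for h
  proof -
    let ?S = "permutation_fps q h"
    have "?S = excursion_fps q h * A + P * ?S"
      using permutation_fps_additive[OF h(1)] by (simp add: A_def P_def)
    then have "?S * (1 - P) = A * excursion_fps q h" by (simp add: algebra_simps)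
    moreover have "(A - 1) * (1 - P) = P" using AP by (simp add: algebra_simps)
    ultimately show ?thesis by (simp add: h(2) mult.assoc)
  qed
  note ef = excursion[OF add(1) mean(1)[folded A_def]]
  note eg = excursion[OF add(2) mean(2)[folded A_def]]
  have "A * excursion_fps q f * (1 - P) = fps_const (- c) * P * (1 - P)" by (simp only: ef)
  moreover have "A * excursion_fps q f * (1 - P) = excursion_fps q f * (A * (1 - P))" by (simp add: mult_ac)
  ultimately show "excursion_fps q f = fps_const (- c) * (P - P * P)"
    by (simp only: AP mult_1_right) (simp add: algebra_simps)
  define F where "F = permutation_fps q (\<lambda>n u. f n u * g n u)"
  define G where "G = excursion_fps q (\<lambda>n u. f n u * g n u)"
  have F: "F = G * A + excursion_fps q f * permutation_fps q g
      + excursion_fps q g * permutation_fps q f + P * F"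
    unfolding F_def G_def A_def P_def by (rule permutation_fps_additive_product[OF add])
  have "F = A * (F * (1 - P))" using AP by (simp add: mult.left_commute)
  also have "F * (1 - P) = G * A + excursion_fps q f * permutation_fps q g
      + excursion_fps q g * permutation_fps q f"
    using F by (simp add: algebra_simps)
  also have "A * \<dots> = A * A * G + (A * excursion_fps q f) * permutation_fps q g
      + (A * excursion_fps q g) * permutation_fps q f"
    by (simp add: algebra_simps)
  \<comment> \<open>The two cross terms coincide because \<open>f\<close> and \<open>g\<close> have
    the same first-moment series.\<close>
  also have "\<dots> = A * A * G + 2 * (fps_const (- c) * P) * (fps_const (- c) * (A - 1))"
    by (simp only: ef eg mean A_def[symmetric] mult_2 distrib_right add.assoc)
  also have "\<dots> = A * A * G + fps_const (2 * c\<^sup>2) * (P * (A - 1))"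
  proof -
    have "fps_const (2 * c\<^sup>2) = 2 * (fps_const (- c) * fps_const (- c))"
      by (simp add: power2_eq_square fps_const_mult_apply_left numeral_fps_const)
    then show ?thesis by (simp only: mult_ac)
  qed
  also have "P * (A - 1) = A - 1 - P" using A by (simp add: algebra_simps)
  finally show "F = A * A * G + fps_const (2 * c\<^sup>2) * (A - 1 - P)" .
qed

section \<open>Centred descent numbers and Mallows covariances\<close>

definition centred :: "real \<Rightarrow> (nat \<Rightarrow> (nat \<Rightarrow> nat) \<Rightarrow> nat) \<Rightarrow> nat \<Rightarrow> (nat \<Rightarrow> nat) \<Rightarrow> real" where
  "centred q d n u = real (d n u) - real n * q / (1 + q)"

lemma des_le: "des n u \<le> n"
  unfolding des_def by (rule order.trans[OF card_mono[of "{1..<n}"]]) auto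

lemma abs_centred_le:
  assumes "0 < q" "d n u \<le> n"
  shows "\<bar>centred q d n u\<bar> \<le> real n"
proof -
  have "0 \<le> real n * q / (1 + q)" "real n * q / (1 + q) \<le> real n"
    using assms by (auto simp: divide_simps algebra_simps)
  then show ?thesis using assms(2) unfolding centred_def by linarith
qed

text \<open>A multiple of the size is additive; subtracting the Mallows mean
  \<open>(n - 1) * q / (1 + q)\<close> instead would destroy additivity.\<close>

lemma block_additive_centred:
  assumes "\<And>m u k v. u permutes {1..m} \<Longrightarrow> v permutes {1..k} \<Longrightarrow> d (m + k) (perm_sum m u v) = d m u + d k v"
  shows "block_additive (centred q d)"
  unfolding block_additive_def centred_def by (simp add: assms distrib_right add_divide_distrib)

lemma block_additive_des: "block_additive (centred q des)"
  by (rule block_additive_centred) (rule des_perm_sum)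

lemma block_additive_des_inv: "block_additive (centred q (\<lambda>n u. des n (inv u)))"
  by (rule block_additive_centred) (simp add: inv_perm_sum des_perm_sum permutes_inv)

text \<open>The Mallows mean of the centred statistic is \<open>- q / (1 + q)\<close> for
  \<open>n \<ge> 1\<close> but \<open>0\<close> for \<open>n = 0\<close>; the subtracted
  \<open>1\<close> removes the constant term accordingly.\<close>

lemma permutation_fps_centred:
  assumes "q > 0"
    and "\<And>n. (\<Sum>u | u permutes {1..n}. excursion_weight q n u * real (d n u))
      = qprod q n * (real (n - 1) * (q / (1 + q)))"
  shows "permutation_fps q (centred q d) = fps_const (- (q / (1 + q))) * (permutation_fps q (\<lambda>_ _. 1) - 1)"
proof (rule fps_ext)
  fix n
  have centred: "centred q d n = (\<lambda>u. real (d n u) - real n * (q / (1 + q)))"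
    by (simp add: centred_def fun_eq_iff)
  have "fps_nth (permutation_fps q (centred q d)) n
    = qprod q n * (real (n - 1) * (q / (1 + q))) - qprod q n * (real n * (q / (1 + q)))"
    unfolding permutation_fps_def centred fps_nth_Abs_fps
    by (simp only: right_diff_distrib sum_subtractf assms(2) sum_distrib_right[symmetric]
        sum_excursion_weight)
  also have "\<dots> = fps_nth (fps_const (- (q / (1 + q))) * (permutation_fps q (\<lambda>_ _. 1) - 1)) n"
    by (cases n) (simp_all add: permutation_fps_one algebra_simps
        del: times_divide_eq_right times_divide_eq_left)
  finally show "fps_nth (permutation_fps q (centred q d)) n
    = fps_nth (fps_const (- (q / (1 + q))) * (permutation_fps q (\<lambda>_ _. 1) - 1)) n" .
qed

lemmas permutation_fps_centred_des = permutation_fps_centred[OF _ sum_excursion_weight_des]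

lemma permutation_fps_centred_des_inv:
  assumes "q > 0"
  shows "permutation_fps q (centred q (\<lambda>n u. des n (inv u)))
    = fps_const (- (q / (1 + q))) * (permutation_fps q (\<lambda>_ _. 1) - 1)"
  by (rule permutation_fps_centred)
     (use assms in \<open>simp_all add: sum_inv_permutes[where f = "\<lambda>u. real (des _ u)"]
        sum_excursion_weight_des del: One_nat_def\<close>)

text \<open>The factor \<open>(1 - q) ^ n\<close> in the weights cancels against the one in
  \<open>qprod q n\<close>.\<close>

lemma integral_mallows:
  assumes "0 < q" "q < 1"
  shows "(LINT u|mallows q n. f u)
    = (\<Sum>u | u permutes {1..n}. excursion_weight q n u * f u) / qprod q n"
proof -
  have "(LINT u|mallows q n. f u) = (\<Sum>u | u permutes {1..n}. f u * pmf (mallows q n) u)"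
    by (rule integral_measure_pmf_real)
       (use assms in \<open>auto simp: finite_permutations set_pmf_eq pmf_mallows split: if_splits\<close>)
  also have "\<dots> = (\<Sum>u | u permutes {1..n}. excursion_weight q n u * f u / qprod q n)"
    by (rule sum.cong) (use assms in \<open>auto simp: pmf_mallows qprod_eq_mallows_weight excursion_weight_def\<close>)
  finally show ?thesis by (simp add: sum_divide_distrib)
qed

text \<open>With \<open>c = q / (1 + q)\<close> both statistics have mean \<open>n * c - c\<close>,
  so their deviations are the centred statistics plus \<open>c\<close>; as these have mean
  \<open>- c\<close>, expanding the product leaves \<open>- c\<^sup>2\<close>.\<close>

lemma covariance_mallows:
  assumes q: "0 < q" "q < 1" and n: "n \<ge> 1"
    and f: "permutation_fps q (centred q d) = fps_const (- (q / (1 + q))) * (permutation_fps q (\<lambda>_ _. 1) - 1)"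
    and g: "permutation_fps q (centred q e) = fps_const (- (q / (1 + q))) * (permutation_fps q (\<lambda>_ _. 1) - 1)"
  shows "covariance (mallows q n) (\<lambda>v. real (d n v)) (\<lambda>v. real (e n v))
    = fps_nth (permutation_fps q (\<lambda>n u. centred q d n u * centred q e n u)) n / qprod q n - (q / (1 + q))\<^sup>2"
proof -
  let ?c = "q / (1 + q)"
  let ?E = "\<lambda>f. (\<Sum>u | u permutes {1..n}. excursion_weight q n u * f u)"
  have pos: "qprod q n \<noteq> 0" using qprod_bounds(1)[OF q, of n] by simp
  have cen: "?E (centred q d n) = - ?c * qprod q n" "?E (centred q e n) = - ?c * qprod q n"
    using arg_cong[OF f, of "\<lambda>f. fps_nth f n"] arg_cong[OF g, of "\<lambda>f. fps_nth f n"] n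
    by (simp_all add: permutation_fps_def sum_excursion_weight del: One_nat_def)
  have mean: "(LINT u|mallows q n. real (d n u)) = real n * ?c - ?c"
    if cen: "?E (centred q d n) = - ?c * qprod q n" for d
  proof -
    have "?E (\<lambda>u. real (d n u)) = ?E (\<lambda>u. centred q d n u + real n * ?c)"
      by (simp add: centred_def)
    also have "\<dots> = ?E (centred q d n) + qprod q n * (real n * ?c)"
      by (simp only: distrib_left sum.distrib sum_distrib_right[symmetric] sum_excursion_weight)
    also have "\<dots> = qprod q n * (real n * ?c - ?c)" unfolding cen by (simp add: right_diff_distrib)
    finally show ?thesis using pos by (simp add: integral_mallows[OF q])
  qed
  have "covariance (mallows q n) (\<lambda>v. real (d n v)) (\<lambda>v. real (e n v))
    = ?E (\<lambda>u. (centred q d n u + ?c) * (centred q e n u + ?c)) / qprod q n"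
  proof -
    have "real (d n u) - (real n * ?c - ?c) = centred q d n u + ?c" for d u
      by (simp add: centred_def)
    then have "covariance (mallows q n) (\<lambda>v. real (d n v)) (\<lambda>v. real (e n v))
      = (LINT u|mallows q n. (centred q d n u + ?c) * (centred q e n u + ?c))"
      by (simp only: covariance_def mean[OF cen(1)] mean[OF cen(2)])
    then show ?thesis by (simp only: integral_mallows[OF q])
  qed
  also have "?E (\<lambda>u. (centred q d n u + ?c) * (centred q e n u + ?c))
    = ?E (\<lambda>u. centred q d n u * centred q e n u) + ?c * ?E (centred q d n)
      + ?c * ?E (centred q e n) + ?c\<^sup>2 * qprod q n"
    unfolding sum_excursion_weight[symmetric, of q n] sum_distrib_left sum.distrib[symmetric]
    by (rule sum.cong) (simp_all add: algebra_simps power2_eq_square)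
  also have "\<dots> = ?E (\<lambda>u. centred q d n u * centred q e n u) - ?c\<^sup>2 * qprod q n"
    by (simp only: cen) (simp add: algebra_simps power2_eq_square)
  finally show ?thesis using pos by (simp add: permutation_fps_def diff_divide_distrib)
qed

subsection \<open>The law of an excursion\<close>

lemma card_unused_below:
  fixes n :: nat
  assumes a: "a permutes {1..n}" and j: "j \<in> {1..n}"
  shows "card {m \<in> {1..} - a ` {1..<j}. m < a j} = card {l \<in> {j<..n}. a l < a j}"
proof -
  have "{m \<in> {1..} - a ` {1..<j}. m < a j} = a ` {l \<in> {j<..n}. a l < a j}"
  proof (intro set_eqI iffI)
    fix m assume m: "m \<in> {m \<in> {1..} - a ` {1..<j}. m < a j}"
    have "a j \<le> n" using j permutes_in_image[OF a, of j] by auto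
    then have "m \<in> {1..n}" using m by simp
    then have "m \<in> a ` {1..n}" by (simp only: permutes_image[OF a])
    then obtain l where l: "m = a l" "l \<in> {1..n}" by blast
    then have "l \<noteq> j" "\<not> l < j" using m by auto
    then show "m \<in> a ` {l \<in> {j<..n}. a l < a j}" using l m by auto
  next
    fix m assume "m \<in> a ` {l \<in> {j<..n}. a l < a j}"
    then obtain l where l: "m = a l" "j < l" "l \<le> n" "a l < a j" by auto
    have "a l \<ge> 1" using permutes_in_image[OF a, of l] l j by auto
    moreover have "a l \<notin> a ` {1..<j}" using l inj_eq[OF permutes_inj[OF a]] by auto
    ultimately show "m \<in> {m \<in> {1..} - a ` {1..<j}. m < a j}" using l by auto
  qed
  then show ?thesis
    using permutes_inj[OF a] by (simp add: card_image inj_on_subset[of _ UNIV])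
qed

lemma perm_inversions_eq_sum: "perm_inversions n a = (\<Sum>j=1..n. card {l \<in> {j<..n}. a l < a j})"
proof -
  have "{(i, j). 1 \<le> i \<and> i < j \<and> j \<le> n \<and> a i > a j} = (SIGMA j:{1..n}. {l \<in> {j<..n}. a l < a j})"
    by auto
  then show ?thesis unfolding perm_inversions_def by (simp add: card_SigmaI)
qed

text \<open>Conditional probabilities multiply along the path, and their exponents add up to the
  number of inversions.\<close>

lemma mallows_process_cylinder:
  assumes mp: "mallows_process q M w" and q: "0 < q" "q < 1" and a: "a permutes {1..n}"
  shows "\<P>(\<omega> in M. \<forall>j\<in>{1..n}. w \<omega> j = a j) = excursion_weight q n a"
proof -
  interpret prob_space M using mp by (simp add: mallows_process_def)
  let ?f = "\<lambda>j. q ^ card {m \<in> {1..} - a ` {1..<j}. m < a j} * (1 - q)"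
  have range: "1 \<le> a i" if "i \<in> {1..n}" for i using that permutes_in_image[OF a, of i] by auto
  have start: "\<P>(\<omega> in M. w \<omega> 1 = k) = q ^ (k - 1) * (1 - q)" if "k \<ge> 1" for k
    using mp that by (simp add: mallows_process_def)
  have step: "\<P>(\<omega> in M. w \<omega> (i + 1) = k \<bar> \<forall>j\<in>{1..i}. w \<omega> j = a j) =
      q ^ card {m \<in> {1..} - a ` {1..i}. m < k} * (1 - q)"
    if "i \<ge> 1" "\<P>(\<omega> in M. \<forall>j\<in>{1..i}. w \<omega> j = a j) > 0" "k \<in> {1..} - a ` {1..i}" for i k
    using mp that unfolding mallows_process_def by blast
  have "\<P>(\<omega> in M. \<forall>j\<in>{1..i}. w \<omega> j = a j) = (\<Prod>j=1..i. ?f j)" if "i \<le> n" for i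
    using that
  proof (induction i)
    case 0
    then show ?case by (simp add: prob_space)
  next
    case (Suc i)
    show ?case
    proof (cases "i = 0")
      case True
      have "{m \<in> {1..} - a ` {1..<1}. m < a 1} = {1..<a 1}" by auto
      then have "card {m \<in> {1..} - a ` {1..<1}. m < a 1} = a 1 - 1" by (simp only: card_atLeastLessThan)
      then show ?thesis using True start[OF range[of 1]] Suc.prems by simp
    next
      case False
      \<comment> \<open>The conditional clause asks for a history of positive probability, which the
        induction hypothesis supplies.\<close>
      have pos: "\<P>(\<omega> in M. \<forall>j\<in>{1..i}. w \<omega> j = a j) > 0"
        using Suc q by (simp add: prod_pos)
      have "a (Suc i) \<in> {1..} - a ` {1..i}"
        using Suc.prems range[of "Suc i"] inj_eq[OF permutes_inj[OF a]] by auto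
      then have "\<P>(\<omega> in M. w \<omega> (i + 1) = a (Suc i) \<and> (\<forall>j\<in>{1..i}. w \<omega> j = a j))
        = \<P>(\<omega> in M. \<forall>j\<in>{1..i}. w \<omega> j = a j) * ?f (Suc i)"
        using step[of i "a (Suc i)"] False pos
        by (simp add: cond_prob_def divide_eq_eq atLeastLessThanSuc_atLeastAtMost mult.commute)
      moreover have "{\<omega> \<in> space M. w \<omega> (i + 1) = a (Suc i) \<and> (\<forall>j\<in>{1..i}. w \<omega> j = a j)}
        = {\<omega> \<in> space M. \<forall>j\<in>{1..Suc i}. w \<omega> j = a j}"
        by (auto simp: le_Suc_eq)
      ultimately show ?thesis using Suc by simp
    qed
  qed
  then have "\<P>(\<omega> in M. \<forall>j\<in>{1..n}. w \<omega> j = a j) = (\<Prod>j=1..n. ?f j)" by blast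
  also have "\<dots> = (\<Prod>j=1..n. q ^ card {l \<in> {j<..n}. a l < a j} * (1 - q))"
    by (intro prod.cong refl) (simp only: card_unused_below[OF a])
  finally show ?thesis
    by (simp add: prod.distrib excursion_weight_def perm_inversions_eq_sum power_sum mult.commute)
qed

text \<open>The target is uncountable and carries its full power set. Still, start and size of the
  block range over a countable set, and for fixed start and size the excursion is a function of a
  finite list of values.\<close>

lemma measurable_excursion:
  assumes mp: "mallows_process q M w" and k: "k \<ge> 1"
  shows "(\<lambda>\<omega>. (excursion (w \<omega>) k, excursion_size (w \<omega>) k)) \<in> measurable M (count_space UNIV)"
    (is "?f \<in> _")
proof -
  have w: "(\<lambda>\<omega>. w \<omega> i) \<in> measurable M (count_space UNIV)" if "i \<ge> 1" for i
    using mp that by (simp add: mallows_process_def)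
  have regen[measurable]: "Measurable.pred M (\<lambda>\<omega>. is_regeneration_time (w \<omega>) n)" for n
  proof -
    have "Measurable.pred M (\<lambda>\<omega>. w \<omega> i \<le> n)" if "i \<in> {1..n}" for i
      by (rule measurable_compose[OF w]) (use that in auto)
    then show ?thesis unfolding is_regeneration_time_def by (intro pred_intros_logic pred_intros_finite) auto
  qed
  have time[measurable]: "(\<lambda>\<omega>. regeneration_time (w \<omega>) j) \<in> measurable M (count_space UNIV)" for j
    by (induction j) simp_all
  define g where "g = (\<lambda>(r, t) \<omega>. (\<lambda>i. if i \<in> {1..t} then card {j \<in> {1..t}. w \<omega> (r + j) \<le> w \<omega> (r + i)} else i, t :: nat))"
  have f: "?f \<omega> = g (regeneration_time (w \<omega>) (k - 1), excursion_size (w \<omega>) k) \<omega>" for \<omega>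
    by (simp add: g_def excursion_def Let_def)
  have g: "g x \<in> measurable M (count_space UNIV)" for x
  proof -
    obtain r t where x: "x = (r, t)" by fastforce
    define h where "h \<omega> = map (\<lambda>i. w \<omega> (r + i)) [1..<Suc t]" for \<omega>
    define G where "G l = (\<lambda>i. if i \<in> {1..t} then card {j \<in> {1..t}. l ! (j - 1) \<le> l ! (i - 1)} else i, t)"
      for l :: "nat list"
    have "h \<in> measurable M (count_space UNIV)"
      unfolding h_def
    proof (induction t)
      case (Suc t)
      have "(\<lambda>\<omega>. l @ [w \<omega> (r + Suc t)]) \<in> measurable M (count_space UNIV)" for l
        by (rule measurable_compose[OF w]) auto
      from measurable_compose_countable[OF this Suc] show ?case by simp
    qed simp
    moreover have "g x \<omega> = G (h \<omega>)" for \<omega>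
    proof -
      have "h \<omega> ! (i - 1) = w \<omega> (r + i)" if "i \<in> {1..t}" for i
        using that by (cases i) (simp_all add: h_def del: upt_Suc)
      then have "{j \<in> {1..t}. h \<omega> ! (j - 1) \<le> h \<omega> ! (i - 1)}
          = {j \<in> {1..t}. w \<omega> (r + j) \<le> w \<omega> (r + i)}" if "i \<in> {1..t}" for i
        using that by auto
      then show ?thesis unfolding g_def G_def x by (simp add: fun_eq_iff)
    qed
    moreover from this have "g x = (\<lambda>\<omega>. G (h \<omega>))" by (simp add: fun_eq_iff)
    ultimately show ?thesis
      using measurable_compose[of h M "count_space UNIV" G "count_space UNIV"] by simp
  qed
  have "(\<lambda>\<omega>. (regeneration_time (w \<omega>) (k - 1), excursion_size (w \<omega>) k)) \<in> measurable M (count_space UNIV)"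
    unfolding excursion_size_def by measurable
  from measurable_compose_countable[OF g this] show ?thesis by (simp only: f)
qed

text \<open>Splitting off the first excursion lowers the count by one and contributes one factor, so
  the \<open>j\<close>-th power collects the concatenations of \<open>j\<close> excursions.\<close>

lemma permutation_fps_regeneration_count:
  "permutation_fps q (\<lambda>n u. of_bool (regeneration_count n u = j)) = excursion_fps q (\<lambda>_ _. 1) ^ j"
proof (induction j)
  case 0
  show ?case
  proof (rule fps_ext)
    fix n
    have "regeneration_count n u \<noteq> 0" if "n \<noteq> 0" "u permutes {1..n}" for u
      using is_regeneration_time_permutes[OF that(2)] that(1) by (auto simp: regeneration_count_def card_eq_0_iff)
    then show "fps_nth (permutation_fps q (\<lambda>n u. of_bool (regeneration_count n u = 0))) n
        = fps_nth (excursion_fps q (\<lambda>_ _. 1) ^ 0) n"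
      by (cases "n = 0") (auto simp: permutation_fps_def excursion_weight_def regeneration_count_def
          intro!: sum.neutral)
  qed
next
  case (Suc j)
  have eq: "permutation_fps q (\<lambda>n u. of_bool (regeneration_count n u = Suc j))
      = fps_const (of_bool (regeneration_count 0 id = Suc j))
        + pair_fps q (\<lambda>m u k v. 1 * of_bool (regeneration_count k v = j))"
  proof (rule permutation_fps_eq_pair_fps)
    fix m u k v assume "u \<in> regeneration_perms 1 m"
    then show "of_bool (regeneration_count (m + k) (perm_sum m u v) = Suc j)
        = 1 * (of_bool (regeneration_count k v = j) :: real)"
      using regeneration_count_perm_sum[of u m k v] by (simp add: regeneration_perms_def)
  qed
  have "regeneration_count 0 id \<noteq> Suc j" by (simp add: regeneration_count_def)
  then show ?case
    by (subst eq) (simp only: pair_fps_product Suc power_Suc of_bool_eq(1) fps_const_0_eq_0 add_0 simp_thms)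
qed

lemma sum_regeneration_perms:
  "(\<Sum>v\<in>regeneration_perms j n. excursion_weight q n v) = fps_nth (excursion_fps q (\<lambda>_ _. 1) ^ j) n"
  unfolding permutation_fps_regeneration_count[symmetric] permutation_fps_def fps_nth_Abs_fps
  by (rule sum.mono_neutral_cong_left) (auto simp: finite_permutations regeneration_perms_def)

text \<open>Values at \<open>z = 1\<close> multiply. Read through
  \<open>sum_regeneration_perms\<close>, the weights of all histories with \<open>j\<close>
  regeneration times add up to \<open>1\<close>.\<close>

lemma excursion_fps_one_sums:
  assumes q: "0 < q" "q < 1"
  shows "fps_nth (excursion_fps q (\<lambda>_ _. 1) ^ j) sums 1"
proof -
  let ?P = "excursion_fps q (\<lambda>_ _. 1)"
  have "fps_nth ?P sums 1"
    by (rule renewal_exponential_tail(2)[OF q])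
       (use permutation_fps_renewal[of q] excursion_fps_one_nonneg[OF q] in \<open>simp_all add: permutation_fps_one\<close>)
  then have P: "abs_sums ?P 1"
    using excursion_fps_one_nonneg[OF q] by (simp add: abs_sums_def sums_iff)
  have "abs_sums (?P ^ j) 1"
  proof (induction j)
    case 0
    have "summable (\<lambda>n. \<bar>fps_nth (1 :: real fps) n\<bar>)"
      by (rule summable_finite[of "{0}"]) auto
    moreover have "fps_nth (1 :: real fps) sums 1"
    proof -
      have "fps_nth (1 :: real fps) = (\<lambda>n. if n = 0 then 1 else 0)" by (rule ext) simp
      then show ?thesis using sums_single[of 0 "\<lambda>_. 1 :: real"] by simp
    qed
    ultimately show ?case by (simp add: abs_sums_def)
  next
    case (Suc j)
    then show ?case using abs_sums_mult[OF P Suc] by simp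
  qed
  then show ?thesis by (simp add: abs_sums_def)
qed

definition excursion_event ::
    "'a measure \<Rightarrow> ('a \<Rightarrow> nat \<Rightarrow> nat) \<Rightarrow> nat \<Rightarrow> nat \<Rightarrow> (nat \<Rightarrow> nat) \<Rightarrow> 'a set" where
  "excursion_event M w k m u = {\<omega> \<in> space M. excursion (w \<omega>) k = u \<and> excursion_size (w \<omega>) k = m}"

lemma excursion_event_sets:
  assumes "mallows_process q M w" "k \<ge> 1"
  shows "excursion_event M w k m u \<in> sets M"
proof -
  have "excursion_event M w k m u = (\<lambda>\<omega>. (excursion (w \<omega>) k, excursion_size (w \<omega>) k)) -` {(u, m)} \<inter> space M"
    by (auto simp: excursion_event_def)
  then show ?thesis using measurable_sets[OF measurable_excursion[OF assms], of "{(u, m)}"] by simp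
qed

text \<open>Each history \<open>v\<close> of \<open>k - 1\<close> excursions, followed by
  \<open>u\<close>, gives a cylinder inside the event. These are disjoint, their weights factor, and
  the histories have total weight \<open>1\<close>, reached as a limit over bounded history
  lengths.\<close>

lemma excursion_event_ge:
  assumes mp: "mallows_process q M w" and q: "0 < q" "q < 1" and k: "k \<ge> 1"
    and u: "u \<in> regeneration_perms 1 m"
  shows "excursion_weight q m u \<le> measure M (excursion_event M w k m u)"
proof -
  interpret prob_space M using mp by (simp add: mallows_process_def)
  obtain j where j: "k = Suc j" using k by (cases k) auto
  define C where "C = (\<lambda>(r, v). {\<omega> \<in> space M. \<forall>i\<in>{1..r + m}. w \<omega> i = perm_sum r v u i})"
  have w: "(\<lambda>\<omega>. w \<omega> i) \<in> measurable M (count_space UNIV)" if "i \<ge> 1" for i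
    using mp that by (simp add: mallows_process_def)
  have C_sets: "C x \<in> sets M" for x
    unfolding C_def case_prod_unfold
    by (intro sets.sets_Collect_finite_All' predE measurable_compose[OF w])
       (use regeneration_perms_1D(2)[OF u] in auto)
  have partial: "(\<Sum>r<N. fps_nth (excursion_fps q (\<lambda>_ _. 1) ^ j) r) * excursion_weight q m u
      \<le> prob (excursion_event M w k m u)" for N
  proof -
    let ?I = "SIGMA r:{..<N}. regeneration_perms j r"
    have sub: "C x \<subseteq> excursion_event M w k m u" if "x \<in> ?I" for x
      using that excursion_agree[OF _ u] by (auto simp: C_def excursion_event_def j)
    \<comment> \<open>On a path in a cylinder, \<open>r\<close> is the \<open>j\<close>-th
      regeneration time and \<open>v\<close> gives the first \<open>r\<close> values, so the path
      determines \<open>(r, v)\<close>.\<close>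
    have disj: "disjoint_family_on C ?I"
      unfolding disjoint_family_on_def
    proof (intro ballI impI)
      fix x y assume x: "x \<in> ?I" and y: "y \<in> ?I" and "x \<noteq> y"
      obtain r v r' v' where xy: "x = (r, v)" "y = (r', v')" by fastforce
      have "x = y" if \<omega>: "\<omega> \<in> C x" "\<omega> \<in> C y" for \<omega>
      proof -
        have eq: "w \<omega> i = v i" if "1 \<le> i" "i \<le> r" for i
          using \<omega>(1) that by (auto simp: C_def xy perm_sum_def)
        have eq': "w \<omega> i = v' i" if "1 \<le> i" "i \<le> r'" for i
          using \<omega>(2) that by (auto simp: C_def xy perm_sum_def)
        have r: "r = r'"
          using regeneration_time_agree[of v j r "w \<omega>", OF _ eq] regeneration_time_agree[of v' j r' "w \<omega>", OF _ eq']
            x y xy by auto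
        have "v permutes {1..r}" "v' permutes {1..r}" using x y xy r by (auto simp: regeneration_perms_def)
        then have "v i = v' i" for i
          using eq[of i] eq'[of i] r by (cases "i \<in> {1..r}") (auto simp: permutes_not_in)
        then show ?thesis using r xy by auto
      qed
      then show "C x \<inter> C y = {}" using \<open>x \<noteq> y\<close> by blast
    qed
    have probC: "prob (C x) = excursion_weight q (fst x) (snd x) * excursion_weight q m u" if "x \<in> ?I" for x
    proof -
      obtain r v where x: "x = (r, v)" by fastforce
      have "v permutes {1..r}" "u permutes {1..m}" using that u x by (auto simp: regeneration_perms_def)
      then show ?thesis
        using mallows_process_cylinder[OF mp q perm_sum_permutes] by (simp add: C_def x excursion_weight_perm_sum)
    qed
    have "(\<Sum>r<N. fps_nth (excursion_fps q (\<lambda>_ _. 1) ^ j) r) * excursion_weight q m u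
        = (\<Sum>x\<in>?I. excursion_weight q (fst x) (snd x) * excursion_weight q m u)"
      by (simp add: sum_regeneration_perms[symmetric] sum_distrib_right sum.Sigma finite_regeneration_perms
          case_prod_unfold)
    also have "\<dots> = (\<Sum>x\<in>?I. prob (C x))" by (rule sum.cong) (simp_all add: probC)
    also have "\<dots> = prob (\<Union>x\<in>?I. C x)"
      by (rule finite_measure_finite_Union[symmetric])
         (use C_sets disj finite_regeneration_perms in auto)
    also have "\<dots> \<le> prob (excursion_event M w k m u)"
      by (rule finite_measure_mono) (use sub excursion_event_sets[OF mp k] in auto)
    finally show ?thesis .
  qed
  have "(\<lambda>N. (\<Sum>r<N. fps_nth (excursion_fps q (\<lambda>_ _. 1) ^ j) r) * excursion_weight q m u)
      \<longlonglongrightarrow> 1 * excursion_weight q m u"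
    by (intro tendsto_intros) (use excursion_fps_one_sums[OF q] in \<open>simp add: sums_def\<close>)
  then show ?thesis using LIMSEQ_le_const2 partial by fastforce
qed

text \<open>
  The lower bounds of \<open>excursion_event_ge\<close> have total mass \<open>1\<close>, so all of them are equalities.
\<close>

lemma excursion_event_eq:
  assumes mp: "mallows_process q M w" and q: "0 < q" "q < 1" and k: "k \<ge> 1"
  shows "u \<in> regeneration_perms 1 m \<Longrightarrow> measure M (excursion_event M w k m u) = excursion_weight q m u"
    and "AE \<omega> in M. \<exists>m. \<exists>u\<in>regeneration_perms 1 m. \<omega> \<in> excursion_event M w k m u"
proof -
  interpret prob_space M using mp by (simp add: mallows_process_def)
  define C where "C = (\<lambda>(m, u). excursion_event M w k m u)"
  define B where "B N = (SIGMA m:{..<N}. regeneration_perms 1 m)" for N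
  define W where "W x = excursion_weight q (fst x) (snd x)" for x
  let ?P = "excursion_fps q (\<lambda>_ _. 1)"
  have fin: "finite (B N)" for N unfolding B_def by (simp add: finite_regeneration_perms)
  have sets: "C x \<in> sets M" for x
    unfolding C_def case_prod_unfold by (rule excursion_event_sets[OF mp k])
  have ge: "W x \<le> prob (C x)" if "x \<in> B N" for x N
    using that excursion_event_ge[OF mp q k] by (auto simp: B_def C_def W_def)
  have total: "(\<Sum>x\<in>B N. W x) = (\<Sum>m<N. fps_nth ?P m)" for N
  proof -
    have "fps_nth ?P m = (\<Sum>u\<in>regeneration_perms 1 m. excursion_weight q m u)" for m
      by (simp add: excursion_fps_def)
    then show ?thesis
      unfolding B_def W_def
      by (simp only: sum.Sigma finite_lessThan finite_regeneration_perms ball_triv case_prod_unfold simp_thms)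
  qed
  have union: "prob (\<Union>x\<in>B N. C x) = (\<Sum>x\<in>B N. prob (C x))" for N
    by (rule finite_measure_finite_Union)
       (use sets fin in \<open>auto simp: disjoint_family_on_def C_def excursion_event_def\<close>)
  have lim: "(\<lambda>N. \<Sum>m<N. fps_nth ?P m) \<longlonglongrightarrow> 1"
    using excursion_fps_one_sums[OF q, of 1] by (simp add: sums_def)
  show "measure M (excursion_event M w k m u) = excursion_weight q m u" if u: "u \<in> regeneration_perms 1 m"
  proof (rule antisym)
    \<comment> \<open>An excess at \<open>(m, u)\<close> adds to the total of the lower bounds, and
      disjointness keeps the result at most \<open>1\<close>; since that total tends to
      \<open>1\<close>, there is no excess.\<close>
    have "(\<Sum>i<N. fps_nth ?P i) + (prob (C (m, u)) - W (m, u)) \<le> 1" if "N \<ge> Suc m" for N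
    proof -
      have mem: "(m, u) \<in> B N" using that u by (simp add: B_def)
      have "(\<Sum>x\<in>B N. W x) + (prob (C (m, u)) - W (m, u))
          = prob (C (m, u)) + (\<Sum>x\<in>B N - {(m, u)}. W x)"
        using sum.remove[OF fin mem, of W] by simp
      also have "\<dots> \<le> prob (C (m, u)) + (\<Sum>x\<in>B N - {(m, u)}. prob (C x))"
        using ge by (intro add_left_mono sum_mono) blast
      also have "\<dots> = prob (\<Union>x\<in>B N. C x)"
        using sum.remove[OF fin mem, of "\<lambda>x. prob (C x)"] union by simp
      also have "\<dots> \<le> 1" by (rule prob_le_1)
      finally show ?thesis by (simp only: total)
    qed
    then have "1 + (prob (C (m, u)) - W (m, u)) \<le> 1"
      by (intro LIMSEQ_le_const2[OF tendsto_add[OF lim tendsto_const]]) blast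
    then show "measure M (excursion_event M w k m u) \<le> excursion_weight q m u"
      by (simp add: C_def W_def)
  qed (rule excursion_event_ge[OF mp q k u])
  \<comment> \<open>The union of all the events has probability \<open>1\<close>, since their lower
    bounds already add up to \<open>1\<close>.\<close>
  define U where "U = (\<Union>N. \<Union>x\<in>B N. C x)"
  have U: "U \<in> sets M" unfolding U_def using sets fin by (intro sets.countable_UN sets.finite_UN) auto
  have "(\<Sum>m<N. fps_nth ?P m) \<le> prob U" for N
  proof -
    have "(\<Sum>m<N. fps_nth ?P m) \<le> prob (\<Union>x\<in>B N. C x)"
      unfolding total[symmetric] union by (rule sum_mono) (rule ge)
    also have "\<dots> \<le> prob U" by (rule finite_measure_mono) (auto simp: U_def intro!: U[unfolded U_def])
    finally show ?thesis .
  qed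
  then have "prob U = 1"
    using LIMSEQ_le_const2[OF lim] prob_le_1[of U] by (meson antisym)
  then have "AE \<omega> in M. \<omega> \<in> U" using U by (simp add: prob_eq_1)
  then show "AE \<omega> in M. \<exists>m. \<exists>u\<in>regeneration_perms 1 m. \<omega> \<in> excursion_event M w k m u"
    by eventually_elim (auto simp: U_def B_def C_def)
qed

text \<open>The integrand is split by size: each \<open>F h m\<close> is a finite combination of
  indicators, almost surely only the actual size contributes, and absolute summability permits
  integration term by term.\<close>

lemma integral_excursion:
  fixes h :: "nat \<Rightarrow> (nat \<Rightarrow> nat) \<Rightarrow> real"
  assumes mp: "mallows_process q M w" and q: "0 < q" "q < 1" and k: "k \<ge> 1"
    and summ: "summable (fps_nth (excursion_fps q (\<lambda>m u. \<bar>h m u\<bar>)))"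
  shows "(LINT \<omega>|M. h (excursion_size (w \<omega>) k) (excursion (w \<omega>) k)) = (\<Sum>m. fps_nth (excursion_fps q h) m)"
proof -
  interpret prob_space M using mp by (simp add: mallows_process_def)
  let ?E = "excursion_event M w k"
  define F where "F h m \<omega> = (\<Sum>u\<in>regeneration_perms 1 m. h m u * indicator (?E m u) \<omega>)"
    for h :: "nat \<Rightarrow> (nat \<Rightarrow> nat) \<Rightarrow> real" and m \<omega>
  note sets[measurable] = excursion_event_sets[OF mp k]
  have int: "integrable M (F h m)" and integral: "(LINT \<omega>|M. F h m \<omega>) = fps_nth (excursion_fps q h) m" for h m
  proof -
    have "integrable M (\<lambda>\<omega>. h m u * indicator (?E m u) \<omega>)" for u
      by (intro integrable_mult_right integrable_real_indicator) (auto simp: emeasure_eq_measure)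
    then show "integrable M (F h m)" "(LINT \<omega>|M. F h m \<omega>) = fps_nth (excursion_fps q h) m"
      unfolding F_def excursion_fps_def
      by (auto intro!: Bochner_Integration.integrable_sum sum.cong
          simp: Bochner_Integration.integral_sum excursion_event_eq(1)[OF mp q k])
  qed
  have Feq: "F h m \<omega> = (if m = excursion_size (w \<omega>) k then h m (excursion (w \<omega>) k) else 0)"
    if "\<omega> \<in> ?E m' u'" "u' \<in> regeneration_perms 1 m'" for h m \<omega> m' u'
  proof -
    have \<omega>: "\<omega> \<in> space M" "u' = excursion (w \<omega>) k" "m' = excursion_size (w \<omega>) k"
      using that by (auto simp: excursion_event_def)
    have "F h m \<omega> = (\<Sum>u\<in>regeneration_perms 1 m. if m = m' \<and> u = u' then h m u else 0)"
      unfolding F_def using \<omega> by (intro sum.cong) (auto simp: excursion_event_def indicator_def)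
    then show ?thesis
      using that(2) \<omega> by (cases "m = m'") (auto simp: finite_regeneration_perms)
  qed
  \<comment> \<open>At most one indicator in the sum is nonzero, so the absolute value passes
    inside.\<close>
  have abs: "norm (F h m \<omega>) = F (\<lambda>m u. \<bar>h m u\<bar>) m \<omega>" for m \<omega>
  proof (cases "\<exists>u\<in>regeneration_perms 1 m. \<omega> \<in> ?E m u")
    case True
    then show ?thesis using Feq by (auto simp: abs_if)
  next
    case False
    then show ?thesis by (simp add: F_def)
  qed
  have "(\<lambda>m. LINT \<omega>|M. F h m \<omega>) sums (LINT \<omega>|M. (\<Sum>m. F h m \<omega>))"
  proof (rule sums_integral)
    show "AE \<omega> in M. summable (\<lambda>m. norm (F h m \<omega>))"
      using excursion_event_eq(2)[OF mp q k]
    proof eventually_elim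
      fix \<omega> assume "\<exists>m. \<exists>u\<in>regeneration_perms 1 m. \<omega> \<in> ?E m u"
      then show "summable (\<lambda>m. norm (F h m \<omega>))"
        using Feq by (intro summable_finite[of "{excursion_size (w \<omega>) k}"]) auto
    qed
    show "summable (\<lambda>m. LINT \<omega>|M. norm (F h m \<omega>))"
      unfolding abs integral by (rule summ)
  qed (rule int)
  moreover have "(LINT \<omega>|M. (\<Sum>m. F h m \<omega>)) = (LINT \<omega>|M. h (excursion_size (w \<omega>) k) (excursion (w \<omega>) k))"
  proof (rule integral_cong_AE)
    show "AE \<omega> in M. (\<Sum>m. F h m \<omega>) = h (excursion_size (w \<omega>) k) (excursion (w \<omega>) k)"
      using excursion_event_eq(2)[OF mp q k]
    proof eventually_elim
      fix \<omega> assume "\<exists>m. \<exists>u\<in>regeneration_perms 1 m. \<omega> \<in> ?E m u"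
      then obtain m' u' where "u' \<in> regeneration_perms 1 m'" "\<omega> \<in> ?E m' u'" by blast
      then have "(\<lambda>m. F h m \<omega>)
          = (\<lambda>m. if m = excursion_size (w \<omega>) k then h m (excursion (w \<omega>) k) else 0)"
        using Feq by auto
      then show "(\<Sum>m. F h m \<omega>) = h (excursion_size (w \<omega>) k) (excursion (w \<omega>) k)"
        using suminf_finite[of "{excursion_size (w \<omega>) k}"
            "\<lambda>m. if m = excursion_size (w \<omega>) k then h m (excursion (w \<omega>) k) else 0"] by simp
    qed
    show "(\<lambda>\<omega>. \<Sum>m. F h m \<omega>) \<in> borel_measurable M"
      using int by (intro borel_measurable_suminf) (rule borel_measurable_integrable)
    show "(\<lambda>\<omega>. h (excursion_size (w \<omega>) k) (excursion (w \<omega>) k)) \<in> borel_measurable M"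
      using measurable_compose[OF measurable_excursion[OF mp k], of "\<lambda>(u, m). h m u" borel] by simp
  qed
  ultimately show ?thesis unfolding integral by (simp add: sums_iff)
qed

section \<open>Convergence of the covariance ratio\<close>

theorem proposition3p9:
  fixes q :: real
    and M :: "'a measure" and w :: "'a \<Rightarrow> nat \<Rightarrow> nat" and k :: nat
    and N :: "'b measure" and w0 :: "'b \<Rightarrow> nat \<Rightarrow> nat" and T0 :: "'b \<Rightarrow> nat"
  assumes "0 < q" and "q < 1"
    and "mallows_process q M w" and "k \<ge> 1"
    and "(\<lambda>x. (w0 x, T0 x)) \<in> measurable N (count_space UNIV)"
    and "distr N (count_space UNIV) (\<lambda>x. (w0 x, T0 x)) =
         distr M (count_space UNIV) (\<lambda>\<omega>. (excursion (w \<omega>) k, excursion_size (w \<omega>) k))"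
  shows
    "(\<lambda>n. covariance (mallows q n) (\<lambda>v. real (des n v)) (\<lambda>v. real (des n (inv v)))
          / prob_space.variance (mallows q n) (\<lambda>v. real (des n v)))
     \<longlonglongrightarrow>
       covariance N (\<lambda>x. real (des (T0 x) (w0 x)) - real (T0 x) * q / (1 + q))
                    (\<lambda>x. real (des (T0 x) (inv (w0 x))) - real (T0 x) * q / (1 + q))
       / prob_space.variance N (\<lambda>x. real (des (T0 x) (w0 x)) - real (T0 x) * q / (1 + q))"
proof -
  note q = assms(1,2) and mp = assms(3) and k = assms(4)
  let ?P = "excursion_fps q (\<lambda>_ _. 1)" and ?c = "q / (1 + q)"
  define X where "X = centred q des"
  define Y where "Y = centred q (\<lambda>n u. des n (inv u))"
  have P0: "fps_nth ?P n \<ge> 0" for n by (rule excursion_fps_one_nonneg[OF q])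
  have ren: "Abs_fps (qprod q) = 1 + ?P * Abs_fps (qprod q)"
    using permutation_fps_renewal[of q] by (simp only: permutation_fps_one)
  have P1: "abs_sums ?P 1"
    using excursion_fps_one_sums[OF q, of 1] P0 by (simp add: abs_sums_def sums_iff)
  obtain \<alpha> where \<alpha>: "\<alpha> > 0" "qprod q \<longlonglongrightarrow> \<alpha>" using qprod_limit[OF q] by blast
  have bound: "\<bar>X n u\<bar> \<le> real n" "\<bar>Y n u\<bar> \<le> real n" for n u
    unfolding X_def Y_def by (intro abs_centred_le q des_le)+
  have additive: "block_additive X" "block_additive Y"
    unfolding X_def Y_def by (rule block_additive_des block_additive_des_inv)+
  have mean: "permutation_fps q X = fps_const (- ?c) * (permutation_fps q (\<lambda>_ _. 1) - 1)"
    "permutation_fps q Y = fps_const (- ?c) * (permutation_fps q (\<lambda>_ _. 1) - 1)"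
    unfolding X_def Y_def
    by (rule permutation_fps_centred_des permutation_fps_centred_des_inv q)+
  have summable_of_bound: "summable (fps_nth (excursion_fps q (\<lambda>m u. \<bar>h m u\<bar>)))"
    if "\<And>m u. \<bar>h m u\<bar> \<le> (real m)\<^sup>2" for h
  proof (rule summable_comparison_test[OF _ renewal_square_summable[OF q ren P0]])
    show "\<exists>N. \<forall>n\<ge>N. norm (fps_nth (excursion_fps q (\<lambda>m u. \<bar>h m u\<bar>)) n) \<le> (real n)\<^sup>2 * fps_nth ?P n"
      using excursion_fps_bound[OF q, of _ "\<lambda>m u. \<bar>h m u\<bar>"] that by auto
  qed
  \<comment> \<open>Only the joint law of \<open>(w0, T0)\<close> enters: integrals over
    \<open>N\<close> become integrals over \<open>M\<close>, and then series.\<close>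
  have transfer: "(LINT x|N. h (T0 x) (w0 x)) = (\<Sum>m. fps_nth (excursion_fps q h) m)"
    if "\<And>m u. \<bar>h m u\<bar> \<le> (real m)\<^sup>2" for h
  proof -
    have "(LINT x|N. h (T0 x) (w0 x)) = (LINT z|distr N (count_space UNIV) (\<lambda>x. (w0 x, T0 x)). h (snd z) (fst z))"
      by (subst integral_distr[OF assms(5)]) simp_all
    also have "\<dots> = (LINT \<omega>|M. h (excursion_size (w \<omega>) k) (excursion (w \<omega>) k))"
      unfolding assms(6) by (subst integral_distr[OF measurable_excursion[OF mp k]]) simp_all
    also have "\<dots> = (\<Sum>m. fps_nth (excursion_fps q h) m)"
      by (rule integral_excursion[OF mp q k summable_of_bound[OF that]])
    finally show ?thesis .
  qed
  have square_bound: "\<bar>f * g\<bar> \<le> (real m)\<^sup>2" if "\<bar>f\<bar> \<le> real m" "\<bar>g\<bar> \<le> real m" for f g :: real and m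
    using mult_mono[OF that] by (simp add: abs_mult power2_eq_square)
  have mean_zero: "(LINT x|N. h (T0 x) (w0 x)) = 0"
    if h: "block_additive h" "permutation_fps q h = fps_const (- ?c) * (permutation_fps q (\<lambda>_ _. 1) - 1)"
      and b: "\<And>n u. \<bar>h n u\<bar> \<le> real n" for h
  proof -
    have "\<bar>h m u\<bar> \<le> (real m)\<^sup>2" for m u
    proof -
      have "real m \<le> (real m)\<^sup>2" by (cases m) (auto simp: power2_eq_square algebra_simps)
      then show ?thesis using b[of m u] by linarith
    qed
    then have "(LINT x|N. h (T0 x) (w0 x)) = (\<Sum>m. fps_nth (fps_const (- ?c) * (?P - ?P * ?P)) m)"
      using transfer[of h] permutation_fps_second_moment(2)[OF h(1) h(1) h(2) h(2)] by simp
    also have "\<dots> = 0"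
    proof -
      \<comment> \<open>The series at hand is \<open>- ?c * (?P - ?P * ?P)\<close>, and
        \<open>?P\<close> has the value \<open>1\<close> at \<open>z = 1\<close>.\<close>
      have "(\<lambda>m. - ?c * fps_nth (?P - ?P * ?P) m) sums (- ?c * (1 - 1 * 1))"
        using abs_sums_diff[OF P1 abs_sums_mult[OF P1 P1]] unfolding abs_sums_def by (intro sums_mult) blast
      then show ?thesis
        unfolding fps_mult_left_const_nth[symmetric] by (simp only: sums_iff) simp
    qed
    finally show ?thesis .
  qed
  have covariance_N: "covariance N (\<lambda>x. X (T0 x) (w0 x)) (\<lambda>x. h (T0 x) (w0 x))
      = (\<Sum>m. fps_nth (excursion_fps q (\<lambda>m u. X m u * h m u)) m)"
    if h: "block_additive h" "permutation_fps q h = fps_const (- ?c) * (permutation_fps q (\<lambda>_ _. 1) - 1)"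
      and b: "\<And>n u. \<bar>h n u\<bar> \<le> real n" for h
    unfolding covariance_def mean_zero[OF additive(1) mean(1) bound(1)] mean_zero[OF h b]
    using transfer[of "\<lambda>m u. X m u * h m u", OF square_bound[OF bound(1) b]] by simp
  \<comment> \<open>Applied to the descents of the inverse and to \<open>des\<close> itself, this
    gives numerator and denominator with the same factor \<open>\<alpha>\<close>.\<close>
  have limit: "(\<lambda>n. covariance (mallows q n) (\<lambda>v. real (des n v)) (\<lambda>v. real (d n v)) / real n)
      \<longlonglongrightarrow> \<alpha> * (\<Sum>m. fps_nth (excursion_fps q (\<lambda>m u. X m u * centred q d m u)) m)"
    if h: "block_additive (centred q d)"
      "permutation_fps q (centred q d) = fps_const (- ?c) * (permutation_fps q (\<lambda>_ _. 1) - 1)"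
      and b: "\<And>n u. \<bar>centred q d n u\<bar> \<le> real n" for d
  proof -
    let ?G = "excursion_fps q (\<lambda>m u. X m u * centred q d m u)"
    let ?F = "permutation_fps q (\<lambda>n u. X n u * centred q d n u)"
    have "(\<lambda>n. (fps_nth ?F n / qprod q n - ?c\<^sup>2) / real n) \<longlonglongrightarrow> \<alpha> * (\<Sum>m. fps_nth ?G m)"
    proof (rule renewal_second_moment_asymptotics[OF q \<alpha>(2,1) ren P0])
      show "\<bar>fps_nth ?G n\<bar> \<le> (real n)\<^sup>2 * fps_nth ?P n" for n
        by (rule excursion_fps_bound[OF q square_bound[OF bound(1) b]])
      show "?F = Abs_fps (qprod q) * Abs_fps (qprod q) * ?G
          + fps_const (2 * ?c\<^sup>2) * (Abs_fps (qprod q) - 1 - ?P)"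
        using permutation_fps_second_moment(1)[OF additive(1) h(1) mean(1) h(2)]
        by (simp only: permutation_fps_one)
    qed
    moreover have "\<forall>\<^sub>F n in sequentially. (fps_nth ?F n / qprod q n - ?c\<^sup>2) / real n
        = covariance (mallows q n) (\<lambda>v. real (des n v)) (\<lambda>v. real (d n v)) / real n"
      using eventually_ge_at_top[of 1]
      by eventually_elim (simp add: covariance_mallows[OF q _ mean(1)[unfolded X_def] h(2)] X_def)
    ultimately show ?thesis by (rule Lim_transform_eventually)
  qed
  let ?sX = "\<Sum>m. fps_nth (excursion_fps q (\<lambda>m u. X m u * X m u)) m"
  let ?sY = "\<Sum>m. fps_nth (excursion_fps q (\<lambda>m u. X m u * Y m u)) m"
  \<comment> \<open>The limit of the denominator must be nonzero. The excursion of size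
    \<open>1\<close> suffices: it has positive weight, and \<open>X\<close> equals
    \<open>- ?c\<close> there.\<close>
  have "?sX > 0"
  proof (rule suminf_pos2[of _ 1])
    have nonneg: "excursion_weight q m u * (X m u * X m u) \<ge> 0" for m u
      using excursion_weight_nonneg[OF q, of m u] by simp
    show "fps_nth (excursion_fps q (\<lambda>m u. X m u * X m u)) m \<ge> 0" for m
      unfolding excursion_fps_def by (auto intro!: sum_nonneg nonneg)
    have id: "id \<in> regeneration_perms 1 1"
    proof -
      have "{i \<in> {1..1::nat}. is_regeneration_time id i} = {1}" by (auto simp: is_regeneration_time_def)
      then show ?thesis by (simp add: regeneration_perms_def regeneration_count_def permutes_id)
    qed
    have "X 1 id = - ?c" by (simp add: X_def centred_def des_def)
    moreover have "excursion_weight q 1 id > 0" using q by (simp add: excursion_weight_def)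
    ultimately have "0 < excursion_weight q 1 id * (X 1 id * X 1 id)" using q by simp
    also have "\<dots> \<le> fps_nth (excursion_fps q (\<lambda>m u. X m u * X m u)) 1"
      unfolding excursion_fps_def fps_nth_Abs_fps
      by (rule member_le_sum[OF id nonneg finite_regeneration_perms])
    finally show "0 < fps_nth (excursion_fps q (\<lambda>m u. X m u * X m u)) 1" .
    show "summable (fps_nth (excursion_fps q (\<lambda>m u. X m u * X m u)))"
      using summable_of_bound[of "\<lambda>m u. X m u * X m u", OF square_bound[OF bound(1) bound(1)]] by simp
  qed
  moreover note limit[OF additive(2)[unfolded Y_def] mean(2)[unfolded Y_def] bound(2)[unfolded Y_def],
      folded Y_def]
  moreover note limit[OF additive(1)[unfolded X_def] mean(1)[unfolded X_def] bound(1)[unfolded X_def],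
      folded X_def]
  ultimately have "(\<lambda>n. (covariance (mallows q n) (\<lambda>v. real (des n v)) (\<lambda>v. real (des n (inv v))) / real n)
      / (covariance (mallows q n) (\<lambda>v. real (des n v)) (\<lambda>v. real (des n v)) / real n))
    \<longlonglongrightarrow> (\<alpha> * ?sY) / (\<alpha> * ?sX)"
    using \<alpha> by (intro tendsto_divide) simp_all
  moreover have "\<forall>\<^sub>F n in sequentially.
      (covariance (mallows q n) (\<lambda>v. real (des n v)) (\<lambda>v. real (des n (inv v))) / real n)
      / (covariance (mallows q n) (\<lambda>v. real (des n v)) (\<lambda>v. real (des n v)) / real n)
    = covariance (mallows q n) (\<lambda>v. real (des n v)) (\<lambda>v. real (des n (inv v)))
      / covariance (mallows q n) (\<lambda>v. real (des n v)) (\<lambda>v. real (des n v))"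
    using eventually_gt_at_top[of 0] by eventually_elim simp
  ultimately have "(\<lambda>n. covariance (mallows q n) (\<lambda>v. real (des n v)) (\<lambda>v. real (des n (inv v)))
      / covariance (mallows q n) (\<lambda>v. real (des n v)) (\<lambda>v. real (des n v)))
    \<longlonglongrightarrow> (\<alpha> * ?sY) / (\<alpha> * ?sX)"
    by (rule Lim_transform_eventually)
  also have "(\<alpha> * ?sY) / (\<alpha> * ?sX) = ?sY / ?sX" using \<alpha> by simp
  finally have "(\<lambda>n. covariance (mallows q n) (\<lambda>v. real (des n v)) (\<lambda>v. real (des n (inv v)))
      / covariance (mallows q n) (\<lambda>v. real (des n v)) (\<lambda>v. real (des n v)))
    \<longlonglongrightarrow> ?sY / ?sX" .
  then show ?thesis
    unfolding covariance_N[OF additive(2) mean(2) bound(2), symmetric]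
      covariance_N[OF additive(1) mean(1) bound(1), symmetric]
    by (simp add: X_def Y_def centred_def covariance_def power2_eq_square)
qed

end
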